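(* Let $n\ge2$, let $w\in S_n$ and $k\in\{1,\ldots,n-1\}$. Then, in $R_n=\mathbb{Z}[x_1,\ldots,x_n,q_{ij}\mid 1\le i<j\le n]$, $$\partial_k(\mathfrak{S}_w^{\mathbf{q}})=\begin{cases}\mathfrak{S}_{ws_k}^{\mathbf{q}}+\eta_k(\mathfrak{S}_w^{\mathbf{q}}) & \text{if } w(k)>w(k+1);\\ 0 & \text{if } w(k)<w(k+1).\end{cases}$$
   Context: Fix $n$; $s_k\in S_n$ is the transposition of $k$ and $k+1$. Convention: $q_{ij}=0$ unless $1\le i<j\le n$. Quantized elementary polynomials: for $0\le j\le n$ let $M_j$ be the $j\times j$ matrix with diagonal entries $x_1,\ldots,x_j$, with $(a,b)$ entry $q_{ab}$ for $a<b$, with entries $-1$ in positions $(a+1,a)$, and $0$ elsewhere. Define $E_i^{(j)}\in R_n$ by $\det(tI_j-M_j)=\sum_{i=0}^{j}(-1)^iE_i^{(j)}t^{j-i}$, with $E_0^{(j)}=1$ and $E_i^{(j)}=0$ unless $0\le i\le j$. Action and divided differences on $R_n$: for $1\le k\le n-1$, $s_k$ acts on $R_n$ by the ring automorphism that swaps $x_k$ and $x_{k+1}$, fixes the other $x_i$, and satisfies, for $1\le i<j\le n$, $s_k(q_{ij})=q_{ij}-q_{i\,j-1}(x_{j-1}-x_j)$ if $k=j-1$; $s_k(q_{ij})=q_{ij}+q_{i+1\,j}(x_i-x_{i+1})$ if $k=i$; $s_k(q_{ij})=q_{ij}$ otherwise (so $s_k(q_{i\,i+1})=q_{i\,i+1}$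 for all $k$). This defines an action of $S_n$, and $\partial_k(F)=\dfrac{F-s_k(F)}{x_k-x_{k+1}}\in R_n$ for $F\in R_n$. Schubert polynomials: $\mathfrak{S}_w\in\mathbb{Z}[x_1,\ldots,x_n]$, $w\in S_n$, are defined by $\mathfrak{S}_{w_0}=x_1^{n-1}x_2^{n-2}\cdots x_{n-1}$ for $w_0(i)=n+1-i$, and $\mathfrak{S}_{ws_k}=\partial_k(\mathfrak{S}_w)$ whenever $w(k)>w(k+1)$ (with $(ws_k)(i)=w(s_k(i))$ and the usual $\partial_k$ on $\mathbb{Z}[x_1,\ldots,x_n]$). With $e_i^{(j)}=e_i(x_1,\ldots,x_j)$, one can write uniquely $\mathfrak{S}_w=\sum c_{i_1,\ldots,i_{n-1}}e_{i_1}^{(1)}\cdots e_{i_{n-1}}^{(n-1)}$ with $c_{i_1,\ldots,i_{n-1}}\in\mathbb{Z}$, $0\le i_p\le p$. Define $E_{i_1,\ldots,i_{n-1}}=E_{i_1}^{(1)}\cdots E_{i_{n-1}}^{(n-1)}$ and $\mathfrak{S}_w^{\mathbf{q}}=\sum c_{i_1,\ldots,i_{n-1}}E_{i_1,\ldots,i_{n-1}}$. The operator $\eta_k$: $\eta_1(E_{i_1,\ldots,i_m})=0$, and for $k\ge2$, $\eta_k(E_{i_1,\ldots,i_m})$ equals $$\sum_{p=1}^{k-1}q_{k-p\,k}\,E_{i_1}^{(1)}\cdots E_{i_{k-2}}^{(k-2)}\Big(\sum_{\ell\ge0}\big(E_{i_{k-1}-\ell-1}^{(k-1)}E_{i_k+\ell-p-1}^{(k-1-p)}-E_{i_{k-1}-\ell-p-1}^{(k-1-p)}E_{i_k+\ell-1}^{(k-1)}\big)\Big)E_{i_{k+1}}^{(k+1)}\cdots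 E_{i_m}^{(m)}.$$ Finally $\eta_k(\mathfrak{S}_w^{\mathbf{q}})=\sum c_{i_1,\ldots,i_{n-1}}\,\eta_k(E_{i_1,\ldots,i_{n-1}})$. *)

theory Defs
  imports
    "Jordan_Normal_Form.Char_Poly"
    "HOL-Library.Poly_Mapping"
    "HOL-Combinatorics.Permutations"
begin

section \<open>The polynomial ring\<close>

datatype var = VX nat | VQ nat nat

text \<open>The order on the variables is irrelevant; it is only there because \<^theory>\<open>HOL-Library.Poly_Mapping\<close>
  obtains the class \<^class>\<open>idom\<close> for polynomials from a linear order on the variables.\<close>

instantiation var :: linorder
begin

fun var_key :: "var \<Rightarrow> nat \<times> nat \<times> nat" where
  "var_key (VX i) = (0, i, 0)"
| "var_key (VQ i j) = (1, i, j)"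

definition less_eq_var :: "var \<Rightarrow> var \<Rightarrow> bool" where
  "less_eq_var u v \<longleftrightarrow> (case (var_key u, var_key v) of ((a, b, c), (a', b', c')) \<Rightarrow>
     a < a' \<or> a = a' \<and> (b < b' \<or> b = b' \<and> c \<le> c'))"

definition less_var :: "var \<Rightarrow> var \<Rightarrow> bool" where
  "less_var u v \<longleftrightarrow> u \<le> v \<and> \<not> v \<le> u"

instance
proof
  have inj: "var_key u = var_key v \<Longrightarrow> u = v" for u v
    by (cases u; cases v) auto
  fix u v w :: var
  show "u < v \<longleftrightarrow> u \<le> v \<and> \<not> v \<le> u"
    by (rule less_var_def)
  show "u \<le> u"
    by (simp add: less_eq_var_def split: prod.splits)
  show "u \<le> w" if "u \<le> v" "v \<le> w"
    using that by (auto simp: less_eq_var_def split: prod.splits)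
  show "u = v" if "u \<le> v" "v \<le> u"
    using that by (intro inj) (auto simp: less_eq_var_def split: prod.splits)
  show "u \<le> v \<or> v \<le> u"
    by (auto simp: less_eq_var_def split: prod.splits)
qed

end

text \<open>Integer polynomials in the variables \<open>x\<^sub>i\<close> (\<^term>\<open>VX i\<close>) and \<open>q\<^sub>i\<^sub>j\<close> (\<^term>\<open>VQ i j\<close>) for
  all natural numbers \<open>i, j\<close>. The ring \<open>R\<^sub>n\<close> is the subring \<open>ringR n\<close> below.\<close>

type_synonym qpoly = "(var \<Rightarrow>\<^sub>0 nat) \<Rightarrow>\<^sub>0 int"

definition ringR :: "nat \<Rightarrow> qpoly set" where
  "ringR n = {F. \<forall>m\<in>Poly_Mapping.keys F.
     Poly_Mapping.keys m \<subseteq> VX ` {1..n} \<union> {VQ i j | i j. 1 \<le> i \<and> i < j \<and> j \<le> n}}"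

definition pvar :: "var \<Rightarrow> qpoly" where
  "pvar v = Poly_Mapping.single (Poly_Mapping.single v 1) 1"

definition xv :: "nat \<Rightarrow> qpoly" where
  "xv i = pvar (VX i)"

definition qv :: "nat \<Rightarrow> nat \<Rightarrow> nat \<Rightarrow> qpoly" where
  "qv n i j = (if 1 \<le> i \<and> i < j \<and> j \<le> n then pvar (VQ i j) else 0)"

text \<open>The ring endomorphism that sends each variable \<open>v\<close> to \<open>f v\<close>.\<close>

definition subst :: "(var \<Rightarrow> qpoly) \<Rightarrow> qpoly \<Rightarrow> qpoly" where
  "subst f F = (\<Sum>m\<in>Poly_Mapping.keys F.
     of_int (Poly_Mapping.lookup F m) *
     (\<Prod>v\<in>Poly_Mapping.keys m. f v ^ Poly_Mapping.lookup m v))"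


section \<open>The action of the simple transpositions and the divided differences\<close>

definition stransp :: "nat \<Rightarrow> nat \<Rightarrow> nat" where
  "stransp k = transpose k (Suc k)"

fun sact_var :: "nat \<Rightarrow> nat \<Rightarrow> var \<Rightarrow> qpoly" where
  "sact_var n k (VX i) = xv (stransp k i)"
| "sact_var n k (VQ i j) =
    (if 1 \<le> i \<and> i < j \<and> j \<le> n then
       (if k = j - 1 then qv n i j - qv n i (j - 1) * (xv (j - 1) - xv j)
        else if k = i then qv n i j + qv n (i + 1) j * (xv i - xv (i + 1))
        else qv n i j)
     else pvar (VQ i j))"

definition sact :: "nat \<Rightarrow> nat \<Rightarrow> qpoly \<Rightarrow> qpoly" where
  "sact n k = subst (sact_var n k)"

text \<open>The quotient \<open>(F - s\<^sub>k F) / (x\<^sub>k - x\<^sub>k\<^sub>+\<^sub>1)\<close> in \<open>R\<^sub>n\<close>. On polynomials in the \<open>x\<^sub>i\<close> alone, \<open>s\<^sub>k\<close> only swaps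
  \<open>x\<^sub>k\<close> and \<open>x\<^sub>k\<^sub>+\<^sub>1\<close>, so there this is the usual divided difference.\<close>

definition ddiff :: "nat \<Rightarrow> nat \<Rightarrow> qpoly \<Rightarrow> qpoly" where
  "ddiff n k F = (THE G. G \<in> ringR n \<and> (xv k - xv (k + 1)) * G = F - sact n k F)"


section \<open>Schubert polynomials and their expansion\<close>

definition longest_perm :: "nat \<Rightarrow> nat \<Rightarrow> nat" where
  "longest_perm n i = (if i \<in> {1..n} then n + 1 - i else i)"

text \<open>The unique family indexed by \<open>S\<^sub>n\<close> (extended by \<open>0\<close>) with the defining recursion.\<close>

definition schubert :: "nat \<Rightarrow> (nat \<Rightarrow> nat) \<Rightarrow> qpoly" where
  "schubert n = (THE S.
     S (longest_perm n) = (\<Prod>i\<in>{1..n}. xv i ^ (n - i)) \<and>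
     (\<forall>w k. w permutes {1..n} \<and> k \<in> {1..n - 1} \<and> w k > w (k + 1) \<longrightarrow>
        S (w \<circ> stransp k) = ddiff n k (S w)) \<and>
     (\<forall>w. \<not> w permutes {1..n} \<longrightarrow> S w = 0))"

definition elem_sym :: "nat \<Rightarrow> nat \<Rightarrow> qpoly" where
  "elem_sym i j = (\<Sum>A\<in>{A. A \<subseteq> {1..j} \<and> card A = i}. \<Prod>a\<in>A. xv a)"

definition elem_indices :: "nat \<Rightarrow> (nat \<Rightarrow> nat) set" where
  "elem_indices n = Pi\<^sub>E {1..n - 1} (\<lambda>p. {0..p})"

definition schubert_coeff :: "nat \<Rightarrow> (nat \<Rightarrow> nat) \<Rightarrow> (nat \<Rightarrow> nat) \<Rightarrow> int" where
  "schubert_coeff n w = (THE c.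
     schubert n w =
       (\<Sum>I\<in>elem_indices n. of_int (c I) * (\<Prod>p\<in>{1..n - 1}. elem_sym (I p) p)) \<and>
     (\<forall>I. I \<notin> elem_indices n \<longrightarrow> c I = 0))"


section \<open>Quantized elementary and Schubert polynomials\<close>

text \<open>Matrices are indexed from \<open>0\<close>, hence the shifts by one.\<close>

definition qmatrix :: "nat \<Rightarrow> nat \<Rightarrow> qpoly mat" where
  "qmatrix n j = mat j j (\<lambda>(a, b).
     if a = b then xv (a + 1)
     else if a < b then qv n (a + 1) (b + 1)
     else if a = b + 1 then - 1
     else 0)"

text \<open>\<^term>\<open>char_poly M\<close> is \<open>det (t I - M)\<close> as a polynomial in \<open>t\<close>. The lower index is an integer because
  the operator \<open>\<eta>\<^sub>k\<close> refers to negative indices.\<close>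

definition qelem :: "nat \<Rightarrow> int \<Rightarrow> nat \<Rightarrow> qpoly" where
  "qelem n i j =
     (if 0 \<le> i \<and> i \<le> int j
      then (- 1) ^ nat i * poly.coeff (char_poly (qmatrix n j)) (j - nat i)
      else 0)"

definition qelem_prod :: "nat \<Rightarrow> (nat \<Rightarrow> nat) \<Rightarrow> qpoly" where
  "qelem_prod n I = (\<Prod>p\<in>{1..n - 1}. qelem n (int (I p)) p)"

definition qschubert :: "nat \<Rightarrow> (nat \<Rightarrow> nat) \<Rightarrow> qpoly" where
  "qschubert n w = (\<Sum>I\<in>elem_indices n. of_int (schubert_coeff n w I) * qelem_prod n I)"

text \<open>The value of \<open>\<eta>\<^sub>k\<close> on the formal symbol \<open>E\<close> with index \<open>I = (i\<^sub>1, \<dots>, i\<^sub>m)\<close>, \<open>m = n - 1\<close>. The sum over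
  \<open>\<ell> \<ge> 0\<close> has only finitely many nonzero terms (\<open>\<ell> < i\<^sub>k\<^sub>-\<^sub>1\<close>), so \<^const>\<open>Sum_any\<close> is the honest sum.\<close>

definition eta_elem :: "nat \<Rightarrow> nat \<Rightarrow> (nat \<Rightarrow> nat) \<Rightarrow> qpoly" where
  "eta_elem n k I = (if k < 2 then 0 else
     (\<Sum>p\<in>{1..k - 1}.
        qv n (k - p) k *
        (\<Prod>r\<in>{1..k - 2}. qelem n (int (I r)) r) *
        Sum_any (\<lambda>l::nat.
            qelem n (int (I (k - 1)) - int l - 1) (k - 1)
              * qelem n (int (I k) + int l - int p - 1) (k - 1 - p)
          - qelem n (int (I (k - 1)) - int l - int p - 1) (k - 1 - p)
              * qelem n (int (I k) + int l - 1) (k - 1)) *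
        (\<Prod>r\<in>{k + 1..n - 1}. qelem n (int (I r)) r)))"

definition eta_qschubert :: "nat \<Rightarrow> nat \<Rightarrow> (nat \<Rightarrow> nat) \<Rightarrow> qpoly" where
  "eta_qschubert n k w = (\<Sum>I\<in>elem_indices n. of_int (schubert_coeff n w I) * eta_elem n k I)"

end

theory Submission
  imports Defs
begin

text \<open>Expanding the Hessenberg determinant shows that the classical polynomials \<open>e\<^sub>i\<^sup>j\<close> and the quantized
  \<open>E\<^sub>i\<^sup>j\<close> obey the same recursion, the former with \<open>q = 0\<close>. From it, \<open>s\<^sub>k\<close> fixes \<open>E\<^sub>i\<^sup>j\<close> for \<open>j \<noteq> k\<close> and
  \<open>\<partial>\<^sub>k\<close> sends \<open>E\<^sub>i\<^sup>k\<close> to the polynomial with both indices lowered by one. So \<open>\<partial>\<^sub>k\<close> turns a standard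
  product into one with two factors of level \<open>k - 1\<close>, and a telescoping exchange rewrites these into
  standard products, with the same coefficients in both cases; the extra \<open>q\<close>-terms in the quantized
  case are exactly \<open>\<eta>\<^sub>k\<close>. Since the standard products \<open>e\<^sub>I\<close> are linearly independent, this gives the
  descent case. In the ascent case \<open>\<SS>\<^sub>w\<^sup>q\<close> is a difference of two \<open>s\<^sub>k\<close>-invariant terms.\<close>

section \<open>Substitution and the ring \<open>R\<^sub>n\<close>\<close>

definition mono_subst :: "(var \<Rightarrow> qpoly) \<Rightarrow> (var \<Rightarrow>\<^sub>0 nat) \<Rightarrow> qpoly" where
  "mono_subst f m = (\<Prod>v\<in>Poly_Mapping.keys m. f v ^ Poly_Mapping.lookup m v)"

lemma mono_subst_superset:
  assumes "finite A" "Poly_Mapping.keys m \<subseteq> A"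
  shows "mono_subst f m = (\<Prod>v\<in>A. f v ^ Poly_Mapping.lookup m v)"
  unfolding mono_subst_def using assms
  by (intro prod.mono_neutral_left) (auto simp: in_keys_iff)

lemma mono_subst_0: "mono_subst f 0 = 1"
  by (simp add: mono_subst_def)

lemma mono_subst_add: "mono_subst f (m + m') = mono_subst f m * mono_subst f m'"
proof -
  let ?A = "Poly_Mapping.keys m \<union> Poly_Mapping.keys m'"
  have "Poly_Mapping.keys (m + m') \<subseteq> ?A"
    by (rule keys_add)
  then show ?thesis
    by (simp add: mono_subst_superset[of ?A] lookup_add power_add prod.distrib)
qed

lemma subst_superset:
  assumes "finite A" "Poly_Mapping.keys F \<subseteq> A"
  shows "subst f F = (\<Sum>m\<in>A. of_int (Poly_Mapping.lookup F m) * mono_subst f m)"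
  unfolding subst_def mono_subst_def[symmetric] using assms
  by (intro sum.mono_neutral_left) (auto simp: in_keys_iff)

lemma subst_add: "subst f (F + G) = subst f F + subst f G"
proof -
  let ?A = "Poly_Mapping.keys F \<union> Poly_Mapping.keys G"
  have "Poly_Mapping.keys (F + G) \<subseteq> ?A"
    by (rule keys_add)
  then show ?thesis
    by (simp add: subst_superset[of ?A] lookup_add ring_distribs sum.distrib)
qed

lemma subst_single: "subst f (Poly_Mapping.single m c) = of_int c * mono_subst f m"
  by (subst subst_superset[of "{m}"]) auto

text \<open>An update at a fresh key adds one monomial, so monomials generate all polynomials
  additively; this reduces multiplicativity of \<open>subst\<close> to
  \<open>mono_subst_add\<close>.\<close>

lemma poly_mapping_single_induct [case_names zero single add]:
  fixes F :: qpoly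
  assumes "P 0" "\<And>m c. P (Poly_Mapping.single m c)" "\<And>F G. P F \<Longrightarrow> P G \<Longrightarrow> P (F + G)"
  shows "P F"
proof (induction F rule: update_induct)
  case const
  then show ?case using assms(1) .
next
  case (update F m c)
  have "Poly_Mapping.update m c F = F + Poly_Mapping.single m c"
    using update by (intro poly_mapping_eqI)
      (auto simp: lookup_update lookup_add lookup_single in_keys_iff when_def)
  then show ?case
    using assms update by simp
qed

lemma subst_mult: "subst f (F * G) = subst f F * subst f G"
proof (induction F rule: poly_mapping_single_induct)
  case zero
  then show ?case by (simp add: subst_def)
next
  case (single m c)
  show ?case
    by (induction G rule: poly_mapping_single_induct)
      (simp_all add: subst_add subst_single mult_single mono_subst_add ring_distribs, simp add: subst_def)
next
  case (add F1 F2)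
  then show ?case by (simp add: subst_add ring_distribs)
qed

lemma subst_1: "subst f 1 = 1"
  using subst_single[of f 0 1] by (simp add: mono_subst_0)

lemma subst_pvar: "subst f (pvar v) = f v"
  by (simp add: pvar_def subst_single mono_subst_def)

lemma sact_add: "sact n k (F + G) = sact n k F + sact n k G"
  by (simp add: sact_def subst_add)

lemma sact_diff: "sact n k (F - G) = sact n k F - sact n k G"
  using sact_add[of n k "F - G" G] by simp

lemma sact_mult: "sact n k (F * G) = sact n k F * sact n k G"
  by (simp add: sact_def subst_mult)

lemma sact_1: "sact n k 1 = 1"
  by (simp add: sact_def subst_1)

lemma sact_0: "sact n k 0 = 0"
  by (simp add: sact_def subst_def)

lemma sact_xv: "sact n k (xv i) = xv (stransp k i)"
  by (simp add: sact_def xv_def subst_pvar)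

text \<open>The formula persists for j > n: there j differs from \<open>Suc k\<close> because k < n,
  and every \<open>qv\<close> with second index j is 0.\<close>

lemma sact_qv:
  assumes "k \<in> {1..<n}" "1 \<le> i" "i < j"
  shows "sact n k (qv n i j) =
    (if j = Suc k then qv n i j - qv n i k * (xv k - xv (Suc k))
     else if i = k then qv n i j + qv n (Suc k) j * (xv k - xv (Suc k))
     else qv n i j)"
proof (cases "j \<le> n")
  case True
  then have "qv n i j = pvar (VQ i j)"
    using assms by (simp add: qv_def)
  then have "sact n k (qv n i j) = sact_var n k (VQ i j)"
    by (simp add: sact_def subst_pvar)
  then show ?thesis
    using assms True by auto
next
  case False
  then have "sact n k (qv n i j) = 0" "j \<noteq> Suc k"
    using assms by (auto simp: qv_def sact_def subst_def)
  then show ?thesis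
    using False by (simp add: qv_def)
qed

section \<open>Closure properties of \<open>ringR n\<close>\<close>

lemma ringR_add: "F \<in> ringR n \<Longrightarrow> G \<in> ringR n \<Longrightarrow> F + G \<in> ringR n"
  using keys_add[of F G] unfolding ringR_def by blast

lemma ringR_uminus: "F \<in> ringR n \<Longrightarrow> - F \<in> ringR n"
  by (auto simp: ringR_def)

lemma ringR_diff: "F \<in> ringR n \<Longrightarrow> G \<in> ringR n \<Longrightarrow> F - G \<in> ringR n"
  using ringR_add[of F n "- G"] ringR_uminus by simp

lemma ringR_mult:
  assumes "F \<in> ringR n" "G \<in> ringR n"
  shows "F * G \<in> ringR n"
  unfolding ringR_def
proof (intro CollectI ballI subsetI)
  fix m v
  assume m: "m \<in> Poly_Mapping.keys (F * G)" and v: "v \<in> Poly_Mapping.keys m"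
  obtain a b where "m = a + b" "a \<in> Poly_Mapping.keys F" "b \<in> Poly_Mapping.keys G"
    using keys_mult[of F G] m by auto
  then show "v \<in> VX ` {1..n} \<union> {VQ i j |i j. 1 \<le> i \<and> i < j \<and> j \<le> n}"
    using assms v keys_add[of a b] unfolding ringR_def by blast
qed

lemma ringR_of_int: "of_int c \<in> ringR n"
proof -
  have "of_int c = (Poly_Mapping.single 0 c :: qpoly)"
    by (simp flip: single_of_int)
  then show ?thesis by (simp add: ringR_def)
qed

lemma ringR_0: "0 \<in> ringR n" and ringR_1: "1 \<in> ringR n"
  using ringR_of_int[of 0 n] ringR_of_int[of 1 n] by simp_all

lemma ringR_sum: "(\<And>a. a \<in> A \<Longrightarrow> f a \<in> ringR n) \<Longrightarrow> sum f A \<in> ringR n"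
  by (induction A rule: infinite_finite_induct) (auto simp: ringR_0 ringR_add)

lemma ringR_prod: "(\<And>a. a \<in> A \<Longrightarrow> f a \<in> ringR n) \<Longrightarrow> prod f A \<in> ringR n"
  by (induction A rule: infinite_finite_induct) (auto simp: ringR_1 ringR_mult)

lemma ringR_xv: "1 \<le> i \<Longrightarrow> i \<le> n \<Longrightarrow> xv i \<in> ringR n"
  by (auto simp: ringR_def xv_def pvar_def)

lemma ringR_qv: "qv n i j \<in> ringR n"
  by (auto simp: ringR_def qv_def pvar_def)

lemma xv_eq_iff: "xv i = xv j \<longleftrightarrow> i = j"
proof -
  have "pvar (VX i) \<noteq> pvar (VX j)" if "i \<noteq> j"
    using that by (metis keys_single one_neq_zero pvar_def singleton_inject var.inject(1))
  then show ?thesis by (auto simp: xv_def)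
qed

text \<open>The ambient ring is an integral domain and x_k - x_(k+1) is nonzero, so the quotient is
  unique; exhibiting one in \<open>ringR n\<close> resolves the description in
  \<open>ddiff\<close>.\<close>

lemma ddiffI:
  assumes "G \<in> ringR n" "(xv k - xv (Suc k)) * G = F - sact n k F"
  shows "ddiff n k F = G"
  unfolding ddiff_def
proof (rule the_equality)
  fix G'
  assume "G' \<in> ringR n \<and> (xv k - xv (k + 1)) * G' = F - sact n k F"
  then have "(xv k - xv (Suc k)) * G' = (xv k - xv (Suc k)) * G"
    using assms by simp
  then show "G' = G"
    by (simp add: xv_eq_iff)
qed (use assms in simp)

section \<open>The recursion of the quantized elementary polynomials\<close>

text \<open>Expansion along the last column: deleting row \<open>a\<close> leaves a block triangular matrix whose second
  diagonal block is unitriangular.\<close>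

lemma det_hessenberg:
  fixes h :: "nat \<Rightarrow> nat \<Rightarrow> 'a :: idom"
  assumes sub: "\<And>a. h (Suc a) a = 1" and low: "\<And>a b. Suc b < a \<Longrightarrow> h a b = 0"
  shows "det (mat (Suc m) (Suc m) (\<lambda>(a, b). h a b)) =
    (\<Sum>a\<le>m. (- 1) ^ (m + a) * h a m * det (mat a a (\<lambda>(a, b). h a b)))"
proof -
  let ?H = "mat (Suc m) (Suc m) (\<lambda>(a, b). h a b)"
  have del: "det (mat_delete ?H a m) = det (mat a a (\<lambda>(a, b). h a b))" if "a \<le> m" for a
  proof -
    let ?B = "mat a (m - a) (\<lambda>(i, j). h i (a + j))"
    let ?D = "mat (m - a) (m - a) (\<lambda>(i, j). h (Suc (a + i)) (a + j))"
    have "mat_delete ?H a m = four_block_mat (mat a a (\<lambda>(a, b). h a b)) ?B (0\<^sub>m (m - a) a) ?D"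
      using that by (intro eq_matI) (auto simp: mat_delete_def intro!: low)
    then have "det (mat_delete ?H a m) = det (mat a a (\<lambda>(a, b). h a b)) * det ?D"
      by (simp add: det_four_block_mat_lower_left_zero[of _ a _ "m - a"])
    moreover have "det ?D = 1"
    proof -
      have "upper_triangular ?D"
        by (intro upper_triangularI) (auto intro!: low)
      moreover have "diag_mat ?D = replicate (m - a) 1"
        by (intro nth_equalityI) (auto simp: diag_mat_def sub)
      ultimately show ?thesis
        by (simp add: det_upper_triangular[of _ "m - a"])
    qed
    ultimately show ?thesis by simp
  qed
  have "det ?H = (\<Sum>a<Suc m. ?H $$ (a, m) * cofactor ?H a m)"
    by (rule laplace_expansion_column) auto
  also have "\<dots> = (\<Sum>a\<le>m. (- 1) ^ (m + a) * h a m * det (mat a a (\<lambda>(a, b). h a b)))"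
    by (auto simp: lessThan_Suc_atMost cofactor_def del intro!: sum.cong) (simp add: add.commute)
  finally show ?thesis .
qed

text \<open>In tI - M the subdiagonal -1 becomes 1, the normalisation that
  \<open>det_hessenberg\<close> requires.\<close>

lemma char_poly_qmatrix:
  "char_poly (qmatrix n j) = det (mat j j (\<lambda>(a, b).
     if a = b then [:- xv (a + 1), 1:]
     else if a < b then [:- qv n (a + 1) (b + 1):]
     else if a = b + 1 then 1
     else 0))"
  unfolding char_poly_def char_poly_matrix_def qmatrix_def
  by (intro arg_cong[of _ _ det] eq_matI) auto

lemma char_poly_qmatrix_Suc:
  "char_poly (qmatrix n (Suc m)) = [:- xv (Suc m), 1:] * char_poly (qmatrix n m)
     - (\<Sum>b<m. [:(- 1) ^ (m + b) * qv n (Suc b) (Suc m):] * char_poly (qmatrix n b))"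
proof -
  have minus: "(- 1) ^ (m + b) * [:- c:] = - [:(- 1) ^ (m + b) * c:]" for b and c :: qpoly
    by (simp add: minus_one_power_iff)
  define h where "h = (\<lambda>a b. if a = b then [:- xv (a + 1), 1:]
     else if a < b then [:- qv n (a + 1) (b + 1):]
     else if a = b + 1 then 1
     else 0)"
  have P: "char_poly (qmatrix n j) = det (mat j j (\<lambda>(a, b). h a b))" for j
    by (simp add: char_poly_qmatrix h_def)
  have "char_poly (qmatrix n (Suc m)) = (\<Sum>a\<le>m. (- 1) ^ (m + a) * h a m * char_poly (qmatrix n a))"
    unfolding P by (rule det_hessenberg) (auto simp: h_def)
  also have "\<dots> = h m m * char_poly (qmatrix n m)
      + (\<Sum>b<m. (- 1) ^ (m + b) * h b m * char_poly (qmatrix n b))"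
    by (simp add: lessThan_Suc_atMost[symmetric])
  also have "(\<Sum>b<m. (- 1) ^ (m + b) * h b m * char_poly (qmatrix n b)) =
      - (\<Sum>b<m. [:(- 1) ^ (m + b) * qv n (Suc b) (Suc m):] * char_poly (qmatrix n b))"
    unfolding sum_negf[symmetric]
  proof (intro sum.cong refl)
    fix b
    assume "b \<in> {..<m}"
    then have "h b m = [:- qv n (Suc b) (Suc m):]"
      by (simp add: h_def)
    then show "(- 1) ^ (m + b) * h b m * char_poly (qmatrix n b) =
        - ([:(- 1) ^ (m + b) * qv n (Suc b) (Suc m):] * char_poly (qmatrix n b))"
      by (simp only: minus mult_minus_left)
  qed
  finally show ?thesis by (simp add: h_def)
qed

lemma degree_char_poly_qmatrix: "degree (char_poly (qmatrix n j)) = j"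
  by (rule degree_monic_char_poly[THEN conjunct1]) (simp add: qmatrix_def)

text \<open>Inverts the definition of \<open>qelem\<close> for every d: beyond the degree both sides
  vanish, so comparing coefficients needs no range conditions.\<close>

lemma coeff_char_poly_qmatrix:
  "poly.coeff (char_poly (qmatrix n j)) d = (- 1) ^ (j + d) * qelem n (int j - int d) j"
proof (cases "d \<le> j")
  case True
  then have "(- 1 :: qpoly) ^ (j + d) = (- 1) ^ (j - d)"
    by (simp add: minus_one_power_iff)
  then show ?thesis
    using True by (simp add: qelem_def nat_diff_distrib flip: of_nat_diff power_add mult.assoc)
next
  case False
  then show ?thesis
    using degree_char_poly_qmatrix by (simp add: coeff_eq_0 qelem_def)
qed

lemma qelem_0: "qelem n i 0 = (if i = 0 then 1 else 0)"
  by (auto simp: qelem_def char_poly_qmatrix)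

text \<open>Reads off the coefficient of t^(m+1-i) in \<open>char_poly_qmatrix_Suc\<close>, with all
  signs collected in the common factor (-1)^(m+d). For i outside 0..m+1 every term is 0.\<close>

lemma qelem_Suc:
  "qelem n i (Suc m) = qelem n i m + xv (Suc m) * qelem n (i - 1) m
     + (\<Sum>b<m. qv n (Suc b) (Suc m) * qelem n (i + int b - int m - 1) b)"
proof (cases "0 \<le> i \<and> i \<le> int (Suc m)")
  case False
  then show ?thesis by (auto simp: qelem_def)
next
  case True
  define d where "d = nat (int (Suc m) - i)"
  have d: "d \<le> Suc m" "i = int (Suc m) - int d"
    using True by (auto simp: d_def)
  let ?P = "\<lambda>j. char_poly (qmatrix n j)"
  have "(- 1) ^ (m + d) * qelem n i (Suc m) = - poly.coeff (?P (Suc m)) d"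
    using d by (simp add: coeff_char_poly_qmatrix)
  also have "\<dots> = xv (Suc m) * poly.coeff (?P m) d - poly.coeff (pCons 0 (?P m)) d
      + (\<Sum>b<m. (- 1) ^ (m + b) * qv n (Suc b) (Suc m) * poly.coeff (?P b) d)"
    by (simp add: char_poly_qmatrix_Suc coeff_sum)
  \<comment> \<open>\<open>pCons 0\<close> multiplies by t and so shifts the coefficient to d - 1.
    For d = 0 it is 0, and so is \<open>qelem n i m\<close>, because then i = m + 1.\<close>
  also have "poly.coeff (pCons 0 (?P m)) d = - ((- 1) ^ (m + d) * qelem n i m)"
  proof (cases d)
    case 0
    then have "qelem n i m = 0"
      using d by (simp add: qelem_def)
    then show ?thesis using 0 by simp
  next
    case (Suc d')
    then have "i = int m - int d'"
      using d by simp
    then show ?thesis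
      using Suc by (simp add: coeff_char_poly_qmatrix)
  qed
  also have "(\<Sum>b<m. (- 1) ^ (m + b) * qv n (Suc b) (Suc m) * poly.coeff (?P b) d) =
      (- 1) ^ (m + d) * (\<Sum>b<m. qv n (Suc b) (Suc m) * qelem n (i + int b - int m - 1) b)"
    unfolding sum_distrib_left
  proof (intro sum.cong refl)
    fix b
    have "(- 1 :: qpoly) ^ (m + d) = (- 1) ^ (m + b) * (- 1) ^ (b + d)"
      by (simp add: minus_one_power_iff)
    then show "(- 1) ^ (m + b) * qv n (Suc b) (Suc m) * poly.coeff (?P b) d =
        (- 1) ^ (m + d) * (qv n (Suc b) (Suc m) * qelem n (i + int b - int m - 1) b)"
      using d by (simp only: coeff_char_poly_qmatrix mult_ac) simp
  qed
  also have "xv (Suc m) * poly.coeff (?P m) d = (- 1) ^ (m + d) * (xv (Suc m) * qelem n (i - 1) m)"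
    using d by (simp add: coeff_char_poly_qmatrix)
  finally have "(- 1) ^ (m + d) * qelem n i (Suc m) = (- 1) ^ (m + d) * (qelem n i m + xv (Suc m) * qelem n (i - 1) m
     + (\<Sum>b<m. qv n (Suc b) (Suc m) * qelem n (i + int b - int m - 1) b))"
    by (simp only: ring_distribs) simp
  then show ?thesis by simp
qed

section \<open>Divided differences of products of elementary polynomials\<close>

text \<open>This covers both the quantized elementary polynomials and, with \<open>q = 0\<close>, the classical ones.\<close>

locale elem_recursion =
  fixes n :: nat and x :: "nat \<Rightarrow> 'a :: idom" and q :: "nat \<Rightarrow> nat \<Rightarrow> 'a"
    and s :: "nat \<Rightarrow> 'a \<Rightarrow> 'a" and E :: "int \<Rightarrow> nat \<Rightarrow> 'a"
  assumes s_add: "s k (F + G) = s k F + s k G"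
    and s_mult: "s k (F * G) = s k F * s k G"
    and s_1: "s k 1 = 1"
    and s_x: "s k (x a) = x (stransp k a)"
    and s_q: "\<lbrakk>k \<in> {1..<n}; 1 \<le> a; a < b\<rbrakk> \<Longrightarrow> s k (q a b) =
      (if b = Suc k then q a b - q a k * (x k - x (Suc k))
       else if a = k then q a b + q (Suc k) b * (x k - x (Suc k))
       else q a b)"
    and q_diag: "q a a = 0"
    and E_0: "E i 0 = (if i = 0 then 1 else 0)"
    and E_Suc: "E i (Suc m) = E i m + x (Suc m) * E (i - 1) m
      + (\<Sum>b<m. q (Suc b) (Suc m) * E (i + int b - int m - 1) b)"
begin

section \<open>Consequences of the recursion and of the action\<close>

lemma s_0: "s k 0 = 0"
  using s_add[of k 0 0] add_cancel_right_right by metis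

lemma s_diff: "s k (F - G) = s k F - s k G"
  using s_add[of k "F - G" G] by simp

lemma s_sum: "s k (sum f A) = (\<Sum>a\<in>A. s k (f a))"
  by (induction A rule: infinite_finite_induct) (auto simp: s_0 s_add)

lemma s_prod: "s k (prod f A) = (\<Prod>a\<in>A. s k (f a))"
  by (induction A rule: infinite_finite_induct) (auto simp: s_1 s_mult)

lemma s_of_int: "s k (of_int c) = of_int c"
proof -
  have "s k (of_nat m) = of_nat m" for m
    by (induction m) (auto simp: s_0 s_1 s_add)
  then show ?thesis
    by (cases c rule: int_diff_cases) (simp add: s_diff)
qed

lemma E_neg: "i < 0 \<Longrightarrow> E i j = 0"
proof (induction j arbitrary: i rule: less_induct)
  case (less j)
  then show ?case
    by (cases j) (auto simp: E_0 E_Suc intro!: sum.neutral)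
qed

lemma E_large: "int j < i \<Longrightarrow> E i j = 0"
proof (induction j arbitrary: i rule: less_induct)
  case (less j)
  then show ?case
    by (cases j) (auto simp: E_0 E_Suc intro!: sum.neutral)
qed

lemma E_index_0: "E 0 j = 1"
  by (induction j) (auto simp: E_0 E_Suc E_neg)

text \<open>The set A is left general because it serves both for membership in
  \<open>ringR n\<close> and, through \<open>lift_rel_closed\<close>, for the set where two ring
  homomorphisms agree.\<close>

lemma E_closed:
  assumes A: "0 \<in> A" "1 \<in> A" "\<And>F G. F \<in> A \<Longrightarrow> G \<in> A \<Longrightarrow> F + G \<in> A"
      "\<And>F G. F \<in> A \<Longrightarrow> G \<in> A \<Longrightarrow> F * G \<in> A"
    and x: "\<And>a. a \<in> {1..n} \<Longrightarrow> x a \<in> A" and q: "\<And>a b. q a b \<in> A"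
    and "j \<le> n"
  shows "E i j \<in> A"
  using \<open>j \<le> n\<close>
proof (induction j arbitrary: i rule: less_induct)
  case (less j)
  have sum: "sum f B \<in> A" if "\<And>b. b \<in> B \<Longrightarrow> f b \<in> A" for f and B :: "nat set"
    using that by (induction B rule: infinite_finite_induct) (auto intro: A)
  show ?case
  proof (cases j)
    case 0
    then show ?thesis by (simp add: E_0 A)
  next
    case (Suc m)
    then show ?thesis
      using less by (auto simp: E_Suc intro!: A x q sum)
  qed
qed

text \<open>One induction proves both cases, since the recursion above k passes through level k.
  Below k nothing moves; at level k only x_k does; at level k + 1 the changes add up to a multiple
  of the recursion for \<open>E (i - 1) k\<close>; higher up the corrections of two summands
  cancel.\<close>

lemma s_E_cases:
  assumes k: "k \<in> {1..<n}"
  shows "if j = k then s k (E i k) = E i k - (x k - x (Suc k)) * E (i - 1) (k - 1)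
         else s k (E i j) = E i j"
proof (induction j arbitrary: i rule: less_induct)
  case (less j)
  define d where "d = x k - x (Suc k)"
  have low: "s k (E i b) = E i b" if "b < j" "b \<noteq> k" for b i
    using less[OF that(1)] that(2) by simp
  have step: "s k (E i (Suc m)) = s k (E i m) + s k (x (Suc m)) * s k (E (i - 1) m)
      + (\<Sum>b<m. s k (q (Suc b) (Suc m)) * s k (E (i + int b - int m - 1) b))" for i m
    by (simp add: E_Suc s_add s_mult s_sum)
  consider "j = 0" | m where "j = Suc m" "Suc m < k" | m where "j = Suc m" "k = Suc m"
    | m where "j = Suc m" "m = k" | m where "j = Suc m" "k < m"
    by (metis linorder_neqE_nat not_less_eq old.nat.exhaust)
  then show ?case
  proof cases
    case 1
    then show ?thesis using k by (auto simp: E_0 s_0 s_1)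
  next
    case 2
    then have "s k (E i j) = E i m + x (Suc m) * E (i - 1) m
        + (\<Sum>b<m. q (Suc b) (Suc m) * E (i + int b - int m - 1) b)"
      using k by (simp add: step low s_x stransp_def s_q)
    then show ?thesis
      using 2 by (simp add: E_Suc)
  next
    case 3
    have "s k (x (Suc m)) = x (Suc k)" "\<And>i. s k (E i m) = E i m"
      using 3 low by (simp_all add: s_x stransp_def)
    moreover have "s k (q (Suc b) (Suc m)) = q (Suc b) (Suc m) \<and> s k (E i b) = E i b" if "b < m" for b i
      using that 3 k low by (auto simp: s_q)
    ultimately have "s k (E i (Suc m)) = E i m + x (Suc k) * E (i - 1) m
        + (\<Sum>b<m. q (Suc b) (Suc m) * E (i + int b - int m - 1) b)"
      unfolding step by simp
    then show ?thesis
      using 3 by (simp add: E_Suc algebra_simps)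
  next
    case 4
    obtain k' where k': "k = Suc k'"
      using k by (cases k) auto
    have "s k (E i j) = E i k - d * E (i - 1) k' + x k * (E (i - 1) k - d * E (i - 1 - 1) k')
      + (\<Sum>b<k. (q (Suc b) (Suc k) - q (Suc b) k * d) * E (i + int b - int k - 1) b)"
    proof -
      have "s k (E i k) = E i k - d * E (i - 1) k'" "s k (x (Suc k)) = x k" for i
        using less[of k i] 4 k' by (simp_all add: d_def s_x stransp_def)
      moreover have "s k (q (Suc b) (Suc k)) = q (Suc b) (Suc k) - q (Suc b) k * d \<and> s k (E i b) = E i b"
        if "b < k" for b i
        using that 4 k low by (auto simp: s_q d_def q_diag)
      ultimately show ?thesis
        unfolding 4 step by simp
    qed
    also have "\<dots> = E i j + d * (E (i - 1) k - E (i - 1) k' - x k * E (i - 1 - 1) k'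
      - (\<Sum>b<k. q (Suc b) k * E (i + int b - int k - 1) b))"
      using 4 by (simp add: E_Suc[of i k] algebra_simps sum.distrib sum_subtractf sum_distrib_left d_def)
    \<comment> \<open>The summand b = k' drops out because q k k = 0.\<close>
    also have "(\<Sum>b<k. q (Suc b) k * E (i + int b - int k - 1) b)
        = (\<Sum>b<k'. q (Suc b) (Suc k') * E ((i - 1) + int b - int k' - 1) b)"
      by (simp add: k' q_diag algebra_simps)
    also have "E (i - 1) k - E (i - 1) k' - x k * E (i - 1 - 1) k' - \<dots> = 0"
      using E_Suc[of "i - 1" k'] by (simp add: k')
    finally show ?thesis
      using 4 by simp
  next
    case 5
    \<comment> \<open>The summand b = k - 1 gains A from the change of q k j, and the summand b = k
      loses A from the change of E at level k.\<close>
    define A where "A = q (Suc k) j * d * E (i + int k - int m - 2) (k - 1)"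
    have "s k (q (Suc b) (Suc m)) * s k (E (i + int b - int m - 1) b) =
        q (Suc b) (Suc m) * E (i + int b - int m - 1) b
        + (if b = k - 1 then A else 0) - (if b = k then A else 0)" if b: "b < m" for b
    proof (cases "b = k")
      case True
      have "s k (E (i + int k - int m - 1) k)
          = E (i + int k - int m - 1) k - d * E (i + int k - int m - 2) (k - 1)"
        using less[of k "i + int k - int m - 1"] 5 by (simp add: d_def algebra_simps)
      then show ?thesis
        unfolding True using 5 k by (simp add: s_q A_def d_def) (auto simp: algebra_simps)
    next
      case False
      then show ?thesis
        using low[of b "i + int b - int m - 1"] 5 k b by (auto simp: s_q A_def d_def algebra_simps)
    qed
    then have "(\<Sum>b<m. s k (q (Suc b) (Suc m)) * s k (E (i + int b - int m - 1) b)) =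
        (\<Sum>b<m. q (Suc b) (Suc m) * E (i + int b - int m - 1) b)"
      using 5 by (simp add: sum.distrib sum_subtractf)
    then have "s k (E i (Suc m)) = E i (Suc m)"
      unfolding step using 5 low by (simp add: E_Suc s_x stransp_def)
    then show ?thesis
      using 5 by simp
  qed
qed

lemma s_E: "k \<in> {1..<n} \<Longrightarrow> j \<noteq> k \<Longrightarrow> s k (E i j) = E i j"
  using s_E_cases[of k j i] by simp

lemma s_E_same:
  "k \<in> {1..<n} \<Longrightarrow> s k (E i k) = E i k - (x k - x (Suc k)) * E (i - 1) (k - 1)"
  using s_E_cases[of k k i] by simp

text \<open>Expanding the two factors of level m + 1 by the recursion, the x (Suc m) terms cancel.
  Thus two factors of level m are traded for products with one factor each in levels m and m + 1, up
  to q-terms and a product with shifted indices.\<close>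

lemma E_mult_exchange:
  "E a m * E b m = E (a - 1) m * E (b + 1) m + (E b m * E a (Suc m) - E (a - 1) m * E (b + 1) (Suc m))
    + (\<Sum>c<m. q (Suc c) (Suc m) *
        (E (a - 1) m * E (b + int c - int m) c - E (a + int c - int m - 1) c * E b m))"
  by (simp add: E_Suc[of _ m] algebra_simps sum_distrib_left sum_subtractf)

text \<open>The exchange iterated L times. Once L exceeds a, the remaining product of two level m
  factors vanishes by \<open>E_neg\<close>.\<close>

lemma E_mult_straighten:
  "E a m * E b m = E (a - int L) m * E (b + int L) m
    + (\<Sum>l<L. E (b + int l) m * E (a - int l) (Suc m) - E (a - int l - 1) m * E (b + int l + 1) (Suc m))
    + (\<Sum>c<m. q (Suc c) (Suc m) * (\<Sum>l<L.
        E (a - int l - 1) m * E (b + int l + int c - int m) c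
          - E (a - int l + int c - int m - 1) c * E (b + int l) m))"
proof (induction L)
  case (Suc L)
  show ?case
    by (subst Suc, subst E_mult_exchange)
       (simp add: algebra_simps sum.distrib sum_subtractf)
qed simp

text \<open>Subtracting the image under \<open>s\<^sub>k\<close> lowers all indices by one and reduces \<open>k\<close>.\<close>

lemma E_independent:
  assumes "k < n" "\<And>j. j \<in> {1..k} \<Longrightarrow> x j \<noteq> x (Suc j)"
    and "\<And>i j. j \<in> {1..k} \<Longrightarrow> s j (G i) = G i"
    and "(\<Sum>i\<le>k. E (int i) k * G i) = 0" "i \<le> k"
  shows "G i = 0"
  using assms
proof (induction k arbitrary: G i)
  case 0
  then show ?case by (simp add: E_0)
next
  case (Suc k)
  have k: "Suc k \<in> {1..<n}" using Suc.prems by simp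
  have "0 = (\<Sum>i\<le>Suc k. E (int i) (Suc k) * G i) - s (Suc k) (\<Sum>i\<le>Suc k. E (int i) (Suc k) * G i)"
    unfolding Suc.prems(4) by (simp add: s_0)
  also have "\<dots> = (\<Sum>i\<le>Suc k. (x (Suc k) - x (Suc (Suc k))) * (E (int i - 1) k * G i))"
    unfolding s_sum sum_subtractf[symmetric]
  proof (intro sum.cong refl)
    fix i
    have "s (Suc k) (G i) = G i"
      using Suc.prems(3) by simp
    then show "E (int i) (Suc k) * G i - s (Suc k) (E (int i) (Suc k) * G i) =
        (x (Suc k) - x (Suc (Suc k))) * (E (int i - 1) k * G i)"
      by (simp add: s_mult s_E_same[OF k] algebra_simps)
  qed
  also have "\<dots> = (x (Suc k) - x (Suc (Suc k))) * (\<Sum>i\<le>k. E (int i) k * G (Suc i))"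
    unfolding sum_distrib_left[symmetric] by (subst sum.atMost_Suc_shift) (simp add: E_neg)
  finally have sum0: "(\<Sum>i\<le>k. E (int i) k * G (Suc i)) = 0"
    using Suc.prems(2)[of "Suc k"] by simp
  have pos: "G (Suc i) = 0" if "i \<le> k" for i
    using Suc.prems sum0 that by (intro Suc.IH[of "\<lambda>i. G (Suc i)"]) auto
  \<comment> \<open>Applying s to the relation eliminated G 0; it is recovered from the original
    relation, where its factor is \<open>E 0 (Suc k)\<close> = 1.\<close>
  then have "(\<Sum>i\<le>Suc k. E (int i) (Suc k) * G i) = G 0"
    by (subst sum.atMost_Suc_shift) (simp add: E_index_0)
  then have "G 0 = 0"
    using Suc.prems by simp
  then show ?case
    using pos Suc.prems(5) by (cases i) auto
qed

section \<open>Standard products and the eta-terms\<close>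

definition elem_prod :: "(nat \<Rightarrow> int) \<Rightarrow> 'a" where
  "elem_prod I = (\<Prod>p\<in>{1..n - 1}. E (I p) p)"

text \<open>The formula for eta_k with the sum over l cut off at L, as finite straightening produces
  it; \<open>eta_elem_eq\<close> says when the cut loses nothing.\<close>

definition eta_upto :: "nat \<Rightarrow> nat \<Rightarrow> (nat \<Rightarrow> int) \<Rightarrow> 'a" where
  "eta_upto L k I = (\<Sum>p\<in>{1..k - 1}. q (k - p) k *
        (\<Prod>r\<in>{1..k - 2}. E (I r) r) *
        (\<Sum>l<L. E (I (k - 1) - int l - 1) (k - 1) * E (I k + int l - int p - 1) (k - 1 - p)
          - E (I (k - 1) - int l - int p - 1) (k - 1 - p) * E (I k + int l - 1) (k - 1)) *
        (\<Prod>r\<in>{k + 1..n - 1}. E (I r) r))"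

lemma elem_prod_eq_0:
  assumes "p \<in> {1..n - 1}" "I p \<notin> {0..int p}"
  shows "elem_prod I = 0"
  unfolding elem_prod_def using assms E_neg E_large by (intro prod_zero) force+

text \<open>Only the factor of level k moves, and its difference has level k - 1. The quotient
  therefore has two factors of level k - 1, which is what must be straightened.\<close>

lemma s_elem_prod:
  assumes k: "k \<in> {1..n - 1}"
  shows "elem_prod I - s k (elem_prod I) = (x k - x (Suc k)) *
    ((\<Prod>p\<in>{1..n - 1} - {k}. E (I p) p) * E (I k - 1) (k - 1))"
proof -
  have k': "k \<in> {1..<n}" using k by auto
  have "elem_prod I = E (I k) k * (\<Prod>p\<in>{1..n - 1} - {k}. E (I p) p)"
    unfolding elem_prod_def using k by (intro prod.remove) auto
  moreover have "s k (\<Prod>p\<in>{1..n - 1} - {k}. E (I p) p) = (\<Prod>p\<in>{1..n - 1} - {k}. E (I p) p)"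
    by (auto simp: s_prod s_E[OF k'] intro!: prod.cong)
  ultimately show ?thesis
    by (simp add: s_mult s_E_same[OF k'] algebra_simps)
qed

text \<open>The product is mapped to itself minus (x_k - x_(k+1)) B with B fixed by s_k, and s_k
  negates x_k - x_(k+1).\<close>

lemma s_s_elem_prod:
  assumes k: "k \<in> {1..n - 1}"
  shows "s k (s k (elem_prod I)) = elem_prod I"
proof -
  define B where "B = (\<Prod>p\<in>{1..n - 1} - {k}. E (I p) p) * E (I k - 1) (k - 1)"
  have k': "k \<in> {1..<n}" using k by auto
  have B: "s k B = B"
    unfolding B_def s_mult s_prod using k'
    by (intro arg_cong2[of _ _ _ _ "(*)"] prod.cong refl s_E) auto
  have s: "s k (elem_prod I) = elem_prod I - (x k - x (Suc k)) * B"
    using s_elem_prod[OF k, of I] by (simp add: B_def algebra_simps)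
  have "s k (x k - x (Suc k)) = - (x k - x (Suc k))"
    by (simp add: s_diff s_x stransp_def)
  then show ?thesis
    by (simp only: s s_diff s_mult B) (simp add: algebra_simps)
qed

text \<open>For k = 1 the new factor \<open>E (I 1 - 1) 0\<close> is 1 or 0. At level 1 the indices
  0 and -1 have these values, so the quotient is already a standard product.\<close>

lemma s_elem_prod_1:
  assumes "n \<ge> 2"
  shows "elem_prod I - s 1 (elem_prod I) =
    (x 1 - x (Suc 1)) * elem_prod (I(1 := if I 1 = 1 then 0 else - 1))"
proof -
  have E1: "E 0 1 = 1" "E (- 1) 1 = 0"
    by (simp_all add: E_neg E_Suc E_0 flip: One_nat_def, simp_all add: E_Suc E_0)
  have "elem_prod (I(1 := if I 1 = 1 then 0 else - 1)) =
     E (if I 1 = 1 then 0 else - 1) 1 * (\<Prod>p\<in>{1..n - 1} - {1}. E (I p) p)"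
    unfolding elem_prod_def using assms by (subst prod.remove[of _ 1]) auto
  then show ?thesis
    using s_elem_prod[of 1 I] assms E1 by (auto simp: E_0)
qed

text \<open>\<open>E_mult_straighten\<close> at level k - 1 with a = I (k - 1) and b = I k - 1. The
  bound on L gives the leftover factor a negative index, so only standard products and the eta-term
  remain.\<close>

lemma s_elem_prod_straighten:
  assumes k: "k \<in> {2..n - 1}" and L: "I (k - 1) < int L"
  shows "elem_prod I - s k (elem_prod I) = (x k - x (Suc k)) *
    ((\<Sum>l<L. elem_prod (I(k - 1 := I k - 1 + int l, k := I (k - 1) - int l))
            - elem_prod (I(k - 1 := I (k - 1) - int l - 1, k := I k + int l))) + eta_upto L k I)"
proof -
  define U where "U = (\<Prod>r\<in>{1..k - 2}. E (I r) r)"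
  define V where "V = (\<Prod>r\<in>{k + 1..n - 1}. E (I r) r)"
  obtain m where m: "k = Suc m"
    using k by (cases k) auto
  have split: "{1..n - 1} - {k} = insert m ({1..k - 2} \<union> {k + 1..n - 1})"
    using k m by auto
  have rest: "(\<Prod>p\<in>{1..n - 1} - {k}. E (J p) p) = U * E (J m) m * V"
    if "\<And>p. p \<noteq> m \<Longrightarrow> p \<noteq> k \<Longrightarrow> J p = I p" for J
  proof -
    have "(\<Prod>r\<in>{1..k - 2}. E (J r) r) = U" "(\<Prod>r\<in>{k + 1..n - 1}. E (J r) r) = V"
      unfolding U_def V_def using k m that by (auto intro!: prod.cong)
    moreover have "(\<Prod>p\<in>{1..n - 1} - {k}. E (J p) p)
        = E (J m) m * ((\<Prod>r\<in>{1..k - 2}. E (J r) r) * (\<Prod>r\<in>{k + 1..n - 1}. E (J r) r))"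
      unfolding split by (subst prod.insert) (use k m in \<open>auto simp: prod.union_disjoint\<close>)
    ultimately show ?thesis by simp
  qed
  have upd: "elem_prod (I(k - 1 := u, k := v)) = U * V * (E u m * E v (Suc m))" for u v
  proof -
    have "elem_prod (I(k - 1 := u, k := v)) =
      E v k * (\<Prod>p\<in>{1..n - 1} - {k}. E ((I(k - 1 := u, k := v)) p) p)"
      unfolding elem_prod_def using k by (subst prod.remove[of _ k]) auto
    then show ?thesis
      using m by (subst (asm) rest) auto
  qed
  \<comment> \<open>Reindexing by c = m - p turns q (k - p) k and level k - 1 - p into q (Suc c)
    (Suc m) and level c.\<close>
  have eta: "eta_upto L k I = U * V * (\<Sum>c<m. q (Suc c) (Suc m) * (\<Sum>l<L.
        E (I m - int l - 1) m * E (I k - 1 + int l + int c - int m) c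
          - E (I m - int l + int c - int m - 1) c * E (I k - 1 + int l) m))"
    unfolding eta_upto_def U_def[symmetric] V_def[symmetric] sum_distrib_left
    by (rule sum.reindex_bij_witness[of _ "\<lambda>c. m - c" "\<lambda>p. m - p"])
       (auto simp: m of_nat_diff algebra_simps Suc_diff_le sum_distrib_left)
  have "E (I m - int L) m = 0"
    using L by (intro E_neg) (simp add: m)
  then have "E (I m) m * E (I k - 1) m = (\<Sum>l<L. E (I k - 1 + int l) m * E (I m - int l) (Suc m)
      - E (I m - int l - 1) m * E (I k - 1 + int l + 1) (Suc m))
    + (\<Sum>c<m. q (Suc c) (Suc m) * (\<Sum>l<L.
        E (I m - int l - 1) m * E (I k - 1 + int l + int c - int m) c
          - E (I m - int l + int c - int m - 1) c * E (I k - 1 + int l) m))"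
    by (subst E_mult_straighten[of _ _ _ L]) simp
  then have "U * E (I m) m * V * E (I k - 1) m = (\<Sum>l<L. U * V * (E (I k - 1 + int l) m * E (I m - int l) (Suc m))
      - U * V * (E (I m - int l - 1) m * E (I k + int l) (Suc m))) + eta_upto L k I"
    by (simp add: eta sum_subtractf sum_distrib_left ring_distribs mult_ac add.commute[of _ 1])
  moreover have "(\<Prod>p\<in>{1..n - 1} - {k}. E (I p) p) = U * E (I m) m * V"
    by (rule rest) simp
  ultimately have "(\<Prod>p\<in>{1..n - 1} - {k}. E (I p) p) * E (I k - 1) (k - 1) =
     (\<Sum>l<L. elem_prod (I(k - 1 := I k - 1 + int l, k := I (k - 1) - int l))
            - elem_prod (I(k - 1 := I (k - 1) - int l - 1, k := I k + int l))) + eta_upto L k I"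
    unfolding upd using m by simp
  moreover have "k \<in> {1..n - 1}" using k by simp
  ultimately show ?thesis
    by (simp only: s_elem_prod)
qed

text \<open>No factor E has level k, and s_k fixes q (k - p) k, whose second index is k and whose
  first is below k.\<close>

lemma s_eta_upto:
  assumes k: "k \<in> {1..n - 1}"
  shows "s k (eta_upto L k I) = eta_upto L k I"
proof -
  have k': "k \<in> {1..<n}" using k by auto
  show ?thesis
    unfolding eta_upto_def s_sum s_mult s_prod s_diff
    using k' by (intro sum.cong arg_cong2[of _ _ _ _ "(*)"] prod.cong arg_cong2[of _ _ _ _ "(-)"] s_E)
      (auto simp: s_q)
qed

end

section \<open>Classical and quantized elementary polynomials\<close>

text \<open>Extends e_i by 0 to negative i, so that the recursion holds for all integer
  indices.\<close>

definition celem :: "int \<Rightarrow> nat \<Rightarrow> qpoly" where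
  "celem i j = (if i < 0 then 0 else elem_sym (nat i) j)"

lemma elem_sym_0: "elem_sym 0 j = 1"
proof -
  have "{A. A \<subseteq> {1..j} \<and> card A = 0} = {{}}"
    using finite_subset[of _ "{1..j}"] by auto
  then show ?thesis by (simp add: elem_sym_def)
qed

lemma elem_sym_Suc_0: "elem_sym (Suc i) 0 = 0"
  unfolding elem_sym_def by (intro sum.neutral) auto

text \<open>Sorts the index sets by whether they contain \<open>Suc m\<close>.\<close>

lemma elem_sym_Suc_Suc:
  "elem_sym (Suc i) (Suc m) = elem_sym (Suc i) m + xv (Suc m) * elem_sym i m"
proof -
  let ?S = "\<lambda>i m. {A. A \<subseteq> {1..m::nat} \<and> card A = i}"
  have fin: "finite (?S i m)" for i m
    by (rule finite_subset[of _ "Pow {1..m}"]) auto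
  have fin': "finite A" "Suc m \<notin> A" if "A \<in> ?S i m" for A i
    using that finite_subset[of A "{1..m}"] by auto
  have inj: "inj_on (insert (Suc m)) (?S i m)"
    by (rule inj_onI) (metis fin'(2) insert_ident)
  have un: "?S (Suc i) (Suc m) = ?S (Suc i) m \<union> insert (Suc m) ` ?S i m"
  proof (intro equalityI subsetI)
    fix A assume A: "A \<in> ?S (Suc i) (Suc m)"
    have "finite A"
      using A finite_subset[of A "{1..Suc m}"] by auto
    show "A \<in> ?S (Suc i) m \<union> insert (Suc m) ` ?S i m"
    proof (cases "Suc m \<in> A")
      case True
      then have "A - {Suc m} \<in> ?S i m" "A = insert (Suc m) (A - {Suc m})"
        using A \<open>finite A\<close> by (auto simp: le_Suc_eq)
      then show ?thesis by blast
    next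
      case False
      then show ?thesis
        using A by (auto simp: le_Suc_eq)
    qed
  next
    fix A assume "A \<in> ?S (Suc i) m \<union> insert (Suc m) ` ?S i m"
    then show "A \<in> ?S (Suc i) (Suc m)"
    proof
      assume "A \<in> insert (Suc m) ` ?S i m"
      then obtain B where "A = insert (Suc m) B" "B \<in> ?S i m" by blast
      then show ?thesis
        using fin'[of B i] by (auto simp: le_Suc_eq)
    qed (auto simp: le_Suc_eq)
  qed
  have disj: "?S (Suc i) m \<inter> insert (Suc m) ` ?S i m = {}"
    by auto
  have "elem_sym (Suc i) (Suc m) = (\<Sum>A\<in>?S (Suc i) m \<union> insert (Suc m) ` ?S i m. \<Prod>a\<in>A. xv a)"
    by (simp only: elem_sym_def un)
  also have "\<dots> = elem_sym (Suc i) m + (\<Sum>A\<in>insert (Suc m) ` ?S i m. \<Prod>a\<in>A. xv a)"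
    unfolding elem_sym_def by (rule sum.union_disjoint[OF fin finite_imageI[OF fin] disj])
  also have "(\<Sum>A\<in>insert (Suc m) ` ?S i m. \<Prod>a\<in>A. xv a) = (\<Sum>A\<in>?S i m. \<Prod>a\<in>insert (Suc m) A. xv a)"
    by (rule sum.reindex_cong[OF inj refl refl])
  also have "\<dots> = xv (Suc m) * elem_sym i m"
    unfolding elem_sym_def sum_distrib_left
  proof (intro sum.cong refl)
    fix A assume A: "A \<in> ?S i m"
    show "(\<Prod>a\<in>insert (Suc m) A. xv a) = xv (Suc m) * (\<Prod>a\<in>A. xv a)"
      by (rule prod.insert[OF fin'[OF A]])
  qed
  finally show ?thesis .
qed

lemma celem_0: "celem i 0 = (if i = 0 then 1 else 0)"
  by (cases "nat i") (auto simp: celem_def elem_sym_0 elem_sym_Suc_0)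

lemma celem_Suc: "celem i (Suc m) = celem i m + xv (Suc m) * celem (i - 1) m"
proof (cases "i \<le> 0")
  case True
  then show ?thesis by (auto simp: celem_def elem_sym_0)
next
  case False
  then obtain i' where "i = int (Suc i')"
    by (metis not_le zero_less_imp_eq_int Suc_pred)
  then show ?thesis
    by (simp add: celem_def elem_sym_Suc_Suc nat_add_distrib)
qed

interpretation Q: elem_recursion n xv "qv n" "sact n" "qelem n" for n
  by unfold_locales
    (fact sact_add sact_mult sact_1 sact_xv sact_qv qelem_0 qelem_Suc | simp add: qv_def)+

text \<open>Both instances share the ring and the action \<open>sact n\<close>; with q = 0 the law
  for q reduces to \<open>sact n k 0 = 0\<close>.\<close>

interpretation C: elem_recursion n xv "\<lambda>_ _. 0" "sact n" celem for n
  by unfold_locales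
    (simp_all add: sact_add sact_mult sact_1 sact_0 sact_xv celem_0 celem_Suc)

lemma qelem_prod_eq: "qelem_prod n I = Q.elem_prod n (int \<circ> I)"
  by (simp add: qelem_prod_def Q.elem_prod_def)

lemma elem_sym_prod_eq: "(\<Prod>p\<in>{1..n - 1}. elem_sym (I p) p) = C.elem_prod n (int \<circ> I)"
  by (simp add: C.elem_prod_def celem_def)

text \<open>From l = I (k - 1) on, each of the two products has a factor with negative
  index.\<close>

lemma eta_elem_eq:
  assumes "2 \<le> k" "I (k - 1) < L"
  shows "eta_elem n k I = Q.eta_upto n L k (int \<circ> I)"
proof -
  have "Sum_any (\<lambda>l::nat.
            qelem n (int (I (k - 1)) - int l - 1) (k - 1)
              * qelem n (int (I k) + int l - int p - 1) (k - 1 - p)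
          - qelem n (int (I (k - 1)) - int l - int p - 1) (k - 1 - p)
              * qelem n (int (I k) + int l - 1) (k - 1)) =
     (\<Sum>l<L. qelem n (int (I (k - 1)) - int l - 1) (k - 1)
              * qelem n (int (I k) + int l - int p - 1) (k - 1 - p)
          - qelem n (int (I (k - 1)) - int l - int p - 1) (k - 1 - p)
              * qelem n (int (I k) + int l - 1) (k - 1))" for p
  proof (rule Sum_any.expand_superset)
    have zero: "qelem n (int (I (k - 1)) - int l - 1) (k - 1) = 0"
      "qelem n (int (I (k - 1)) - int l - int p - 1) (k - 1 - p) = 0" if "\<not> l < L" for l
      using that assms by (auto intro!: Q.E_neg)
    show "{l. qelem n (int (I (k - 1)) - int l - 1) (k - 1)
              * qelem n (int (I k) + int l - int p - 1) (k - 1 - p)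
          - qelem n (int (I (k - 1)) - int l - int p - 1) (k - 1 - p)
              * qelem n (int (I k) + int l - 1) (k - 1) \<noteq> 0} \<subseteq> {..<L}"
      by (intro subsetI, rule ccontr) (simp add: zero del: One_nat_def diff_diff_left)
  qed simp
  then show ?thesis
    using assms by (simp add: eta_elem_def Q.eta_upto_def)
qed

text \<open>Peels off the lowest level m: grouping by the index there gives a relation among the
  e_i^(m), which \<open>E_independent\<close> splits into one relation per index on the levels above
  m.\<close>

lemma celem_prod_independent:
  assumes "m + d = n" "1 \<le> m"
    and "(\<Sum>I\<in>Pi\<^sub>E {m..n - 1} (\<lambda>p. {0..p}). of_int (c I) * (\<Prod>p\<in>{m..n - 1}. celem (int (I p)) p)) = 0"
    and "I \<in> Pi\<^sub>E {m..n - 1} (\<lambda>p. {0..p})"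
  shows "c I = 0"
  using assms
proof (induction d arbitrary: m c I)
  case 0
  then show ?case by simp
next
  case (Suc d)
  let ?J = "{Suc m..n - 1}"
  have ins: "{m..n - 1} = insert m ?J" "m \<notin> ?J"
    using Suc.prems by auto
  \<comment> \<open>G i is the coefficient of \<open>celem i m\<close>. It contains only levels
    above m, hence is fixed by s_1, ..., s_m, as \<open>E_independent\<close> demands.\<close>
  define G where "G = (\<lambda>i. \<Sum>g\<in>Pi\<^sub>E ?J (\<lambda>p. {0..p}). of_int (c (g(m := i))) * (\<Prod>p\<in>?J. celem (int (g p)) p))"
  have "(\<Sum>I\<in>Pi\<^sub>E {m..n - 1} (\<lambda>p. {0..p}). of_int (c I) * (\<Prod>p\<in>{m..n - 1}. celem (int (I p)) p)) =
    (\<Sum>(i, g)\<in>{0..m} \<times> Pi\<^sub>E ?J (\<lambda>p. {0..p}). of_int (c (g(m := i))) *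
       (\<Prod>p\<in>insert m ?J. celem (int ((g(m := i)) p)) p))"
    unfolding ins(1) PiE_insert_eq
    by (subst sum.reindex) (use ins(2) in \<open>auto intro!: inj_combinator sum.cong\<close>)
  also have "\<dots> = (\<Sum>(i, g)\<in>{0..m} \<times> Pi\<^sub>E ?J (\<lambda>p. {0..p}). celem (int i) m *
       (of_int (c (g(m := i))) * (\<Prod>p\<in>?J. celem (int (g p)) p)))"
  proof (intro sum.cong refl, clarify)
    fix i g
    have "(\<Prod>p\<in>insert m ?J. celem (int ((g(m := i)) p)) p) = celem (int i) m * (\<Prod>p\<in>?J. celem (int ((g(m := i)) p)) p)"
      using ins(2) by (subst prod.insert) auto
    also have "(\<Prod>p\<in>?J. celem (int ((g(m := i)) p)) p) = (\<Prod>p\<in>?J. celem (int (g p)) p)"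
      by (intro prod.cong) auto
    finally show "of_int (c (g(m := i))) * (\<Prod>p\<in>insert m ?J. celem (int ((g(m := i)) p)) p) =
        celem (int i) m * (of_int (c (g(m := i))) * (\<Prod>p\<in>?J. celem (int (g p)) p))"
      by simp
  qed
  also have "\<dots> = (\<Sum>i\<le>m. celem (int i) m * G i)"
    unfolding G_def sum_distrib_left atMost_atLeast0
    by (rule sum.cartesian_product[symmetric])
  finally have sum0: "(\<Sum>i\<le>m. celem (int i) m * G i) = 0"
    using Suc.prems by simp
  have inv: "sact n j (G i) = G i" if "j \<in> {1..m}" for i j
    unfolding G_def C.s_sum[of n] sact_mult C.s_prod[of n] C.s_of_int[of n]
    using that Suc.prems by (intro sum.cong refl arg_cong2[of _ _ _ _ "(*)"] prod.cong C.s_E) auto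
  have G0: "G i = 0" if "i \<le> m" for i
    using Suc.prems sum0 inv that
    by (intro C.E_independent[of m n G]) (auto simp: xv_eq_iff)
  have "restrict I ?J \<in> Pi\<^sub>E ?J (\<lambda>p. {0..p})" "I m \<le> m"
    using Suc.prems ins by auto
  then have "c ((restrict I ?J)(m := I m)) = 0"
    using Suc.prems G0[of "I m"] unfolding G_def
    by (intro Suc.IH[of "Suc m" "\<lambda>g. c (g(m := I m))"]) auto
  moreover have "(restrict I ?J)(m := I m) = I"
    using Suc.prems(4) ins by (auto simp: PiE_def extensional_def fun_eq_iff)
  ultimately show ?case by simp
qed

section \<open>Quantization as a relation\<close>

definition lift_by :: "nat \<Rightarrow> ((nat \<Rightarrow> nat) \<Rightarrow> int) \<Rightarrow> qpoly \<Rightarrow> qpoly \<Rightarrow> bool" where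
  "lift_by n c F G \<longleftrightarrow>
     F = (\<Sum>I\<in>elem_indices n. of_int (c I) * (\<Prod>p\<in>{1..n - 1}. elem_sym (I p) p)) \<and>
     G = (\<Sum>I\<in>elem_indices n. of_int (c I) * qelem_prod n I)"

text \<open>\<open>G\<close> is the quantization of \<open>F\<close>. As a relation it passes
  through sums and differences before uniqueness of the coefficients is invoked.\<close>

definition lift_rel :: "nat \<Rightarrow> qpoly \<Rightarrow> qpoly \<Rightarrow> bool" where
  "lift_rel n F G \<longleftrightarrow> (\<exists>c. lift_by n c F G)"

lemma finite_elem_indices: "finite (elem_indices n)"
  unfolding elem_indices_def by (intro finite_PiE) auto

lemma elem_sym_prod_independent:
  assumes "n \<ge> 1"
    and "(\<Sum>I\<in>elem_indices n. of_int (c I) * (\<Prod>p\<in>{1..n - 1}. elem_sym (I p) p)) =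
         (\<Sum>I\<in>elem_indices n. of_int (c' I) * (\<Prod>p\<in>{1..n - 1}. elem_sym (I p) p))"
    and "I \<in> elem_indices n"
  shows "c I = c' I"
proof -
  have "c I - c' I = 0"
    using assms unfolding elem_indices_def
    by (intro celem_prod_independent[of 1 "n - 1" n "\<lambda>I. c I - c' I"])
      (simp_all add: celem_def left_diff_distrib sum_subtractf)
  then show ?thesis by simp
qed

lemma lift_rel_unique:
  assumes "n \<ge> 1" "lift_rel n F G" "lift_rel n F G'"
  shows "G = G'"
  using assms elem_sym_prod_independent[OF assms(1)]
  unfolding lift_rel_def lift_by_def by (auto intro!: sum.cong)

lemma lift_rel_0: "lift_rel n 0 0"
  unfolding lift_rel_def lift_by_def by (rule exI[of _ "\<lambda>_. 0"]) simp

lemma lift_rel_add: "lift_rel n F G \<Longrightarrow> lift_rel n F' G' \<Longrightarrow> lift_rel n (F + F') (G + G')"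
  unfolding lift_rel_def lift_by_def
  by (elim exE, rule exI[of _ "\<lambda>I. c I + c' I" for c c']) (simp add: ring_distribs sum.distrib)

lemma lift_rel_of_int: "lift_rel n F G \<Longrightarrow> lift_rel n (of_int a * F) (of_int a * G)"
  unfolding lift_rel_def lift_by_def
  by (elim exE, rule exI[of _ "\<lambda>I. a * c I" for c]) (simp add: sum_distrib_left mult.assoc)

lemma lift_rel_diff: "lift_rel n F G \<Longrightarrow> lift_rel n F' G' \<Longrightarrow> lift_rel n (F - F') (G - G')"
  using lift_rel_add[of n F G "of_int (- 1) * F'" "of_int (- 1) * G'"] lift_rel_of_int[of n F' G' "- 1"]
  by simp

lemma lift_rel_sum:
  "(\<And>a. a \<in> A \<Longrightarrow> lift_rel n (f a) (g a)) \<Longrightarrow> lift_rel n (sum f A) (sum g A)"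
  by (induction A rule: infinite_finite_induct) (auto intro: lift_rel_0 lift_rel_add)

text \<open>Straightening may leave the index range, but then the classical and the quantized
  product are both 0.\<close>

lemma lift_rel_elem_prod: "lift_rel n (C.elem_prod n J) (Q.elem_prod n J)"
proof (cases "\<forall>p\<in>{1..n - 1}. J p \<in> {0..int p}")
  case True
  define I where "I = (\<lambda>p\<in>{1..n - 1}. nat (J p))"
  have I: "I \<in> elem_indices n"
    using True by (auto simp: I_def elem_indices_def)
  have J: "C.elem_prod n J = (\<Prod>p\<in>{1..n - 1}. elem_sym (I p) p)" "Q.elem_prod n J = qelem_prod n I"
    using True by (auto simp: C.elem_prod_def Q.elem_prod_def qelem_prod_def I_def celem_def intro!: prod.cong)
  show ?thesis
    unfolding lift_rel_def lift_by_def J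
    by (rule exI[of _ "\<lambda>I'. if I' = I then 1 else 0"])
      (simp add: I finite_elem_indices if_distrib[of of_int] if_distrib[of "\<lambda>x. x * _"] cong: if_cong)
next
  case False
  then obtain p where "p \<in> {1..n - 1}" "J p \<notin> {0..int p}" by blast
  then have "C.elem_prod n J = 0" "Q.elem_prod n J = 0"
    using C.elem_prod_eq_0 Q.elem_prod_eq_0 by blast+
  then show ?thesis by (simp add: lift_rel_0)
qed

lemma qelem_ringR: "j \<le> n \<Longrightarrow> qelem n i j \<in> ringR n"
  by (rule Q.E_closed) (auto intro: ringR_0 ringR_1 ringR_add ringR_mult ringR_xv ringR_qv)

lemma celem_closed:
  assumes "0 \<in> A" "1 \<in> A" "\<And>F G. F \<in> A \<Longrightarrow> G \<in> A \<Longrightarrow> F + G \<in> A"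
      "\<And>F G. F \<in> A \<Longrightarrow> G \<in> A \<Longrightarrow> F * G \<in> A"
    and "\<And>a. a \<in> {1..n} \<Longrightarrow> xv a \<in> A" "j \<le> n"
  shows "celem i j \<in> A"
  using assms by (intro C.E_closed[of A n j i]) auto

text \<open>F is an integer polynomial in x_1, ..., x_n, so it lies in every subring containing
  them.\<close>

lemma lift_rel_closed:
  assumes F: "lift_rel n F G"
    and A: "1 \<in> A" "\<And>F G. F \<in> A \<Longrightarrow> G \<in> A \<Longrightarrow> F - G \<in> A"
      "\<And>F G. F \<in> A \<Longrightarrow> G \<in> A \<Longrightarrow> F * G \<in> A"
    and x: "\<And>a. a \<in> {1..n} \<Longrightarrow> xv a \<in> A"
  shows "F \<in> A"
proof -
  have A0: "0 \<in> A"
    using A(2)[OF A(1) A(1)] by simp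
  have Aadd: "F + G \<in> A" if "F \<in> A" "G \<in> A" for F G
    using A(2)[OF that(1) A(2)[OF A0 that(2)]] by simp
  have "of_nat i \<in> A" for i
    by (induction i) (auto simp: A0 A Aadd)
  then have Aint: "of_int c \<in> A" for c
    by (cases c rule: int_diff_cases) (simp add: A)
  have Asum: "sum f B \<in> A" if "\<And>b. b \<in> B \<Longrightarrow> f b \<in> A" for f and B :: "(nat \<Rightarrow> nat) set"
    using that by (induction B rule: infinite_finite_induct) (auto intro: A0 Aadd)
  have Aprod: "prod f B \<in> A" if "\<And>b. b \<in> B \<Longrightarrow> f b \<in> A" for f and B :: "nat set"
    using that by (induction B rule: infinite_finite_induct) (auto intro: A)
  have "celem i j \<in> A" if "j \<le> n" for i j
    using that A A0 Aadd x by (intro celem_closed[of A n]) auto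
  from this[of _ "int _"] have "elem_sym i j \<in> A" if "j \<le> n" for i j
    using that by (simp add: celem_def)
  then show ?thesis
    using F unfolding lift_rel_def lift_by_def by (auto intro!: Asum A Aint Aprod)
qed

lemma lift_rel_ringR:
  assumes "lift_rel n F G"
  shows "F \<in> ringR n" "G \<in> ringR n"
proof -
  show "F \<in> ringR n"
    by (rule lift_rel_closed[OF assms]) (auto intro: ringR_1 ringR_diff ringR_mult ringR_xv)
  show "G \<in> ringR n"
    using assms unfolding lift_rel_def lift_by_def qelem_prod_def
    by (auto intro!: ringR_sum ringR_mult ringR_of_int ringR_prod qelem_ringR)
qed

lemma eta_elem_ringR:
  assumes "k \<in> {1..n - 1}"
  shows "eta_elem n k I \<in> ringR n"
proof (cases "k < 2")
  case True
  then show ?thesis by (simp add: eta_elem_def ringR_0)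
next
  case False
  obtain L where "I (k - 1) < L" by blast
  then have "eta_elem n k I = Q.eta_upto n L k (int \<circ> I)"
    using False by (intro eta_elem_eq) auto
  then show ?thesis
    unfolding Q.eta_upto_def using assms
    by (auto intro!: ringR_sum ringR_mult ringR_diff ringR_qv ringR_prod qelem_ringR)
qed

lemma sact_eta_elem:
  assumes "k \<in> {1..n - 1}"
  shows "sact n k (eta_elem n k I) = eta_elem n k I"
  using eta_elem_eq[of k I "Suc (I (k - 1))" n] Q.s_eta_upto[OF assms]
  by (cases "k < 2") (auto simp: eta_elem_def sact_0)

text \<open>The classical and the quantized product are straightened by the same coefficients, up to the
  \<open>q\<close>-terms collected in \<open>\<eta>\<^sub>k\<close>.\<close>

lemma sact_elem_prod:
  assumes k: "k \<in> {1..n - 1}"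
  obtains F G where "lift_rel n F G"
    "C.elem_prod n (int \<circ> I) - sact n k (C.elem_prod n (int \<circ> I)) = (xv k - xv (Suc k)) * F"
    "qelem_prod n I - sact n k (qelem_prod n I) = (xv k - xv (Suc k)) * (G + eta_elem n k I)"
proof (cases "k = 1")
  case True
  then have n: "n \<ge> 2" using k by auto
  show ?thesis
    using C.s_elem_prod_1[OF n, of "int \<circ> I"] Q.s_elem_prod_1[OF n, of "int \<circ> I"] True
    by (intro that[OF lift_rel_elem_prod]) (simp_all only: qelem_prod_eq, simp_all add: eta_elem_def)
next
  case False
  let ?L = "Suc (I (k - 1))" and ?I = "int \<circ> I"
  have k2: "k \<in> {2..n - 1}" "2 \<le> k" and L: "?I (k - 1) < int ?L"
    using k False by auto
  \<comment> \<open>With q = 0 the classical quotient is exactly the straightened sum.\<close>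
  have "C.eta_upto n ?L k ?I = 0"
    by (simp add: C.eta_upto_def)
  then show ?thesis
    using C.s_elem_prod_straighten[OF k2(1), of ?I ?L, OF L] Q.s_elem_prod_straighten[OF k2(1), of ?I ?L, OF L]
    by (intro that[OF lift_rel_sum[OF lift_rel_diff[OF lift_rel_elem_prod lift_rel_elem_prod]]])
      (simp_all only: qelem_prod_eq eta_elem_eq[OF k2(2) lessI] add_0_right)
qed

text \<open>Linear extension of \<open>sact_elem_prod\<close>. The last two equations record that
  the divisions are exact, which the description in \<open>ddiff\<close> alone does not
  provide.\<close>

lemma ddiff_lift_by:
  assumes k: "k \<in> {1..n - 1}" and c: "lift_by n c F G"
  defines "h \<equiv> \<Sum>I\<in>elem_indices n. of_int (c I) * eta_elem n k I"
  obtains G' where "lift_rel n (ddiff n k F) G'" "ddiff n k G = G' + h"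
    "(xv k - xv (Suc k)) * ddiff n k F = F - sact n k F"
    "(xv k - xv (Suc k)) * ddiff n k G = G - sact n k G"
proof -
  have "\<exists>F G. lift_rel n F G \<and>
    C.elem_prod n (int \<circ> I) - sact n k (C.elem_prod n (int \<circ> I)) = (xv k - xv (Suc k)) * F \<and>
    qelem_prod n I - sact n k (qelem_prod n I) = (xv k - xv (Suc k)) * (G + eta_elem n k I)" for I
    by (rule sact_elem_prod[OF k]) blast
  then obtain f g where fg: "lift_rel n (f I) (g I)"
    "C.elem_prod n (int \<circ> I) - sact n k (C.elem_prod n (int \<circ> I)) = (xv k - xv (Suc k)) * f I"
    "qelem_prod n I - sact n k (qelem_prod n I) = (xv k - xv (Suc k)) * (g I + eta_elem n k I)" for I
    by metis
  define F' where "F' = (\<Sum>I\<in>elem_indices n. of_int (c I) * f I)"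
  define G' where "G' = (\<Sum>I\<in>elem_indices n. of_int (c I) * g I)"
  have lift: "lift_rel n F' G'"
    unfolding F'_def G'_def by (intro lift_rel_sum lift_rel_of_int fg)
  have F: "(xv k - xv (Suc k)) * F' = F - sact n k F"
    using c unfolding lift_by_def elem_sym_prod_eq
    by (simp add: F'_def C.s_sum[of n] sact_mult C.s_of_int[of n] sum_distrib_left mult.left_commute
        fg(2)[symmetric] sum_subtractf right_diff_distrib)
  have G: "(xv k - xv (Suc k)) * (G' + h) = G - sact n k G"
    using c unfolding lift_by_def
    by (simp add: G'_def h_def C.s_sum[of n] sact_mult C.s_of_int[of n] sum_distrib_left mult.left_commute
        fg(3)[symmetric] sum_subtractf right_diff_distrib sum.distrib[symmetric] distrib_left[symmetric])
  have "h \<in> ringR n"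
    unfolding h_def by (intro ringR_sum ringR_mult ringR_of_int eta_elem_ringR k)
  then have "ddiff n k F = F'" "ddiff n k G = G' + h"
    using F G lift_rel_ringR[OF lift] by (auto intro!: ddiffI ringR_add)
  then show ?thesis
    using that lift F G by metis
qed

section \<open>Braid relations and Schubert polynomials\<close>

text \<open>The span of the classical standard products: stable under divided differences, and made
  of polynomials in the x_i, so identities between compositions of the s_k can be tested on the
  x_i.\<close>

definition xspan :: "nat \<Rightarrow> qpoly set" where
  "xspan n = {F. \<exists>G. lift_rel n F G}"

lemma ddiff_xspan:
  assumes "k \<in> {1..n - 1}" "F \<in> xspan n"
  shows "ddiff n k F \<in> xspan n"
    and "(xv k - xv (Suc k)) * ddiff n k F = F - sact n k F"
proof -
  obtain c G where c: "lift_by n c F G"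
    using assms by (auto simp: xspan_def lift_rel_def)
  show "ddiff n k F \<in> xspan n"
    by (rule ddiff_lift_by[OF assms(1) c]) (auto simp: xspan_def)
  show "(xv k - xv (Suc k)) * ddiff n k F = F - sact n k F"
    by (rule ddiff_lift_by[OF assms(1) c])
qed

text \<open>The set where f and g agree is a subring containing every x_a.\<close>

lemma xspan_hom_eq:
  fixes f g :: "qpoly \<Rightarrow> qpoly"
  assumes F: "F \<in> xspan n"
    and f: "f 1 = 1" "\<And>F G. f (F - G) = f F - f G" "\<And>F G. f (F * G) = f F * f G"
    and g: "g 1 = 1" "\<And>F G. g (F - G) = g F - g G" "\<And>F G. g (F * G) = g F * g G"
    and x: "\<And>a. f (xv a) = g (xv a)"
  shows "f F = g F"
proof -
  obtain G where "lift_rel n F G"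
    using F by (auto simp: xspan_def)
  then have "F \<in> {F. f F = g F}"
    by (rule lift_rel_closed) (auto simp: f g x)
  then show ?thesis by simp
qed

section \<open>Commutation and braid relations\<close>

lemma sact_commute:
  assumes "F \<in> xspan n" "Suc k < j"
  shows "sact n k (sact n j F) = sact n j (sact n k F)"
  using assms(1) by (rule xspan_hom_eq)
    (use assms(2) in \<open>auto simp: sact_1 sact_diff sact_mult sact_xv stransp_def transpose_def\<close>)

lemma sact_braid:
  assumes "F \<in> xspan n"
  shows "sact n k (sact n (Suc k) (sact n k F)) = sact n (Suc k) (sact n k (sact n (Suc k) F))"
  using assms by (rule xspan_hom_eq)
    (auto simp: sact_1 sact_diff sact_mult sact_xv stransp_def transpose_def)

lemma sact_involution:
  assumes "F \<in> xspan n"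
  shows "sact n k (sact n k F) = F"
  using assms by (rule xspan_hom_eq)
    (auto simp: sact_1 sact_diff sact_mult sact_xv stransp_def)

lemma ddiff_commute:
  assumes "F \<in> xspan n" "k \<in> {1..n - 1}" "j \<in> {1..n - 1}" "Suc k < j"
  shows "ddiff n k (ddiff n j F) = ddiff n j (ddiff n k F)"
proof -
  define a b where "a = xv k - xv (Suc k)" and "b = xv j - xv (Suc j)"
  have ab: "a \<noteq> 0" "b \<noteq> 0" "sact n j a = a" "sact n k b = b"
    using assms by (auto simp: a_def b_def xv_eq_iff sact_diff sact_xv stransp_def)
  \<comment> \<open>Since s_i' fixes b', both denominators clear, leaving an expression symmetric in
    i and i' once the two actions commute.\<close>
  have twice: "b' * (a' * ddiff n i' (ddiff n i F)) = F - sact n i F - sact n i' F + sact n i' (sact n i F)"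
    if i: "i \<in> {1..n - 1}" "i' \<in> {1..n - 1}" "b' = xv i - xv (Suc i)" "a' = xv i' - xv (Suc i')"
       "sact n i' b' = b'" for i i' a' b'
  proof -
    have 1: "b' * ddiff n i F = F - sact n i F"
      using ddiff_xspan(2)[OF i(1) assms(1)] i by simp
    have 2: "a' * ddiff n i' (ddiff n i F) = ddiff n i F - sact n i' (ddiff n i F)"
      using ddiff_xspan(2)[OF i(2) ddiff_xspan(1)[OF i(1) assms(1)]] i by simp
    have "b' * sact n i' (ddiff n i F) = sact n i' F - sact n i' (sact n i F)"
      using arg_cong[OF 1, of "sact n i'"] i(5) by (simp add: sact_mult sact_diff)
    then show ?thesis
      unfolding 2 right_diff_distrib 1 by simp
  qed
  have "b * (a * ddiff n k (ddiff n j F)) = a * (b * ddiff n j (ddiff n k F))"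
    using twice[of j k b a] twice[of k j a b] assms ab sact_commute[OF assms(1,4)]
    by (simp add: a_def[symmetric] b_def[symmetric])
  then show ?thesis
    using ab by simp
qed

text \<open>Clearing denominators turns the triple quotient into the signed sum over S_3. Kept
  abstract for use with s and t in both roles; the braid relation identifies the two
  results.\<close>

lemma braid_expand:
  fixes s t :: "'a :: idom \<Rightarrow> 'a"
  assumes s: "\<And>F G. s (F - G) = s F - s G" "\<And>F G. s (F * G) = s F * s G"
    and t: "\<And>F G. t (F - G) = t F - t G" "\<And>F G. t (F * G) = t F * t G"
    and ab: "s a = - a" "s b = a + b" "t a = a + b" "a \<noteq> 0"
    and ss: "s (s F) = F"
    and 1: "a * F1 = F - s F" and 2: "b * F2 = F1 - t F1" and 3: "a * F3 = F2 - s F2"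
  shows "a * b * (a + b) * F3 = F - s F - t F + t (s F) + s (t F) - s (t (s F))"
proof -
  have tF1: "(a + b) * t F1 = t F - t (s F)"
    using arg_cong[OF 1, of t] by (simp add: t ab)
  have 4: "a * (a + b) * (b * F2) = (a + b) * (F - s F) - a * (t F - t (s F))"
    unfolding 1[symmetric] 2 tF1[symmetric] by (simp add: algebra_simps)
  have sa: "s (a + b) = b"
    using s(1)[of "a + b" a] ab by (simp add: algebra_simps)
  have "s (a * (a + b) * (b * F2)) = - a * b * ((a + b) * s F2)"
    by (simp add: s sa ab)
  moreover have "s (a * (a + b) * (b * F2)) = b * (s F - s (s F)) + a * (s (t F) - s (t (s F)))"
    unfolding 4 by (simp add: s sa ab)
  ultimately have 5: "- a * b * ((a + b) * s F2) = b * (s F - F) + a * (s (t F) - s (t (s F)))"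
    using ss by simp
  have "a * (a * b * (a + b) * F3) = a * b * (a + b) * (a * F3)"
    by (simp add: mult_ac)
  also have "\<dots> = a * (a + b) * (b * F2) + (- a * b * ((a + b) * s F2))"
    unfolding 3 by (simp add: algebra_simps)
  also have "\<dots> = a * (F - s F - t F + t (s F) + s (t F) - s (t (s F)))"
    unfolding 4 5 by (simp add: algebra_simps)
  finally show ?thesis
    using ab by simp
qed

lemma ddiff_braid:
  assumes F: "F \<in> xspan n" and k: "k \<in> {1..n - 1}" "Suc k \<in> {1..n - 1}"
  shows "ddiff n k (ddiff n (Suc k) (ddiff n k F)) = ddiff n (Suc k) (ddiff n k (ddiff n (Suc k) F))"
proof -
  define a b where "a = xv k - xv (Suc k)" and "b = xv (Suc k) - xv (Suc (Suc k))"
  have "a + b = xv k - xv (Suc (Suc k))"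
    by (simp add: a_def b_def)
  then have ab: "a \<noteq> 0" "b \<noteq> 0" "a + b \<noteq> 0" "sact n k a = - a" "sact n k b = a + b"
    "sact n (Suc k) a = a + b" "sact n (Suc k) b = - b"
    by (auto simp: a_def b_def xv_eq_iff sact_diff sact_xv stransp_def transpose_def)
  note mult = ddiff_xspan(2)[OF k(1), folded a_def] ddiff_xspan(2)[OF k(2), folded b_def]
  note closed = ddiff_xspan(1)[OF k(1)] ddiff_xspan(1)[OF k(2)]
  have "a * b * (a + b) * ddiff n k (ddiff n (Suc k) (ddiff n k F)) =
      F - sact n k F - sact n (Suc k) F + sact n (Suc k) (sact n k F) + sact n k (sact n (Suc k) F)
        - sact n k (sact n (Suc k) (sact n k F))"
    by (rule braid_expand[where ?F1.0 = "ddiff n k F" and ?F2.0 = "ddiff n (Suc k) (ddiff n k F)"])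
      (simp_all add: sact_diff sact_mult ab sact_involution mult closed F)
  moreover have "b * a * (b + a) * ddiff n (Suc k) (ddiff n k (ddiff n (Suc k) F)) =
      F - sact n (Suc k) F - sact n k F + sact n k (sact n (Suc k) F) + sact n (Suc k) (sact n k F)
        - sact n (Suc k) (sact n k (sact n (Suc k) F))"
    by (rule braid_expand[where ?F1.0 = "ddiff n (Suc k) F" and ?F2.0 = "ddiff n k (ddiff n (Suc k) F)"])
      (simp_all add: sact_diff sact_mult ab sact_involution mult closed F add.commute)
  ultimately have "a * b * (a + b) * ddiff n k (ddiff n (Suc k) (ddiff n k F)) =
      a * b * (a + b) * ddiff n (Suc k) (ddiff n k (ddiff n (Suc k) F))"
    by (simp add: sact_braid[OF F] mult.commute[of b a] add.commute[of b a])
  then show ?thesis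
    using ab by simp
qed

section \<open>Weights and ascents of permutations\<close>

definition perm_weight :: "nat \<Rightarrow> (nat \<Rightarrow> nat) \<Rightarrow> nat" where
  "perm_weight n w = (\<Sum>i\<in>{1..n}. i * w i)"

text \<open>Swapping an ascent lowers the weight by w (k + 1) - w k, so the weight is a measure for
  climbing towards the longest permutation.\<close>

lemma perm_weight_stransp:
  assumes k: "k \<in> {1..n - 1}" and less: "w k < w (Suc k)"
  shows "perm_weight n (w \<circ> stransp k) < perm_weight n w"
proof -
  have split: "{1..n} = insert k (insert (Suc k) ({1..n} - {k, Suc k}))"
    using k by auto
  have sum: "perm_weight n v = k * v k + (Suc k * v (Suc k) + (\<Sum>i\<in>{1..n} - {k, Suc k}. i * v i))" for v
    unfolding perm_weight_def by (subst split) simp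
  have "(\<Sum>i\<in>{1..n} - {k, Suc k}. i * (w \<circ> stransp k) i) = (\<Sum>i\<in>{1..n} - {k, Suc k}. i * w i)"
    by (intro sum.cong) (auto simp: stransp_def)
  then show ?thesis
    unfolding sum using less by (simp add: stransp_def)
qed

text \<open>Without ascents w decreases strictly; counting down from position 1 and up from position
  n squeezes w i to n + 1 - i.\<close>

lemma exists_ascent:
  assumes w: "w permutes {1..n}" and "w \<noteq> longest_perm n"
  shows "\<exists>k\<in>{1..n - 1}. w k < w (Suc k)"
proof (rule ccontr)
  assume asm: "\<not> ?thesis"
  have desc: "w (Suc k) < w k" if "k \<in> {1..n - 1}" for k
    using asm that permutes_inj[OF w] by (metis inj_eq linorder_neqE_nat n_not_Suc_n)
  have range: "1 \<le> w i \<and> w i \<le> n" if "i \<in> {1..n}" for i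
    using permutes_in_image[OF w, of i] that by auto
  have upper: "Suc i \<le> n \<Longrightarrow> w (Suc i) + i \<le> n" for i
  proof (induction i)
    case 0
    then show ?case using range[of 1] by simp
  next
    case (Suc i)
    then have "w (Suc (Suc i)) < w (Suc i)"
      by (intro desc) auto
    then show ?case using Suc by simp
  qed
  have lower: "i < n \<Longrightarrow> i + 1 \<le> w (n - i)" for i
  proof (induction i)
    case 0
    then show ?case using range[of n] by simp
  next
    case (Suc i)
    then have "n - Suc i \<in> {1..n - 1}" "Suc (n - Suc i) = n - i"
      by auto
    then have "w (n - i) < w (n - Suc i)"
      using desc by metis
    then show ?case using Suc by simp
  qed
  have "w i = longest_perm n i" for i
  proof (cases "i \<in> {1..n}")
    case True
    then show ?thesis
      using upper[of "i - 1"] lower[of "n - i"] by (simp add: longest_perm_def)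
  next
    case False
    then show ?thesis
      using w by (auto simp: longest_perm_def permutes_def)
  qed
  then show False
    using assms by auto
qed

lemma longest_perm_no_ascent: "k \<in> {1..n - 1} \<Longrightarrow> \<not> longest_perm n k < longest_perm n (Suc k)"
  by (auto simp: longest_perm_def)

lemma longest_perm_permutes: "longest_perm n permutes {1..n}"
proof (rule bij_imp_permutes)
  show "bij_betw (longest_perm n) {1..n} {1..n}"
    by (rule bij_betw_byWitness[where f' = "longest_perm n"]) (auto simp: longest_perm_def)
qed (auto simp: longest_perm_def)

lemma stransp_permutes: "k \<in> {1..n - 1} \<Longrightarrow> stransp k permutes {1..n}"
  unfolding stransp_def by (rule permutes_swap_id) auto

lemma comp_stransp_permutes:
  "w permutes {1..n} \<Longrightarrow> k \<in> {1..n - 1} \<Longrightarrow> (w \<circ> stransp k) permutes {1..n}"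
  by (rule permutes_compose[OF stransp_permutes])

lemma stransp_apply: "stransp k k = Suc k" "stransp k (Suc k) = k"
  by (simp_all add: stransp_def)

lemma comp_stransp_twice: "w \<circ> stransp k \<circ> stransp k = w"
  by (simp add: stransp_def fun_eq_iff)

section \<open>Recursive construction of the Schubert polynomials\<close>

definition ascents :: "nat \<Rightarrow> (nat \<Rightarrow> nat) \<Rightarrow> nat set" where
  "ascents n w = {k\<in>{1..n - 1}. w k < w (Suc k)}"

definition first_ascent :: "nat \<Rightarrow> (nat \<Rightarrow> nat) \<Rightarrow> nat" where
  "first_ascent n w = (LEAST k. k \<in> ascents n w)"

lemma first_ascent: "ascents n w \<noteq> {} \<Longrightarrow> first_ascent n w \<in> ascents n w"
  unfolding first_ascent_def by (rule LeastI_ex) blast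

text \<open>The family is built by descending from the longest permutation along the least ascent; the
  diamond argument below shows that every other ascent gives the same result.\<close>

function schubert_rec :: "nat \<Rightarrow> (nat \<Rightarrow> nat) \<Rightarrow> qpoly" where
  "schubert_rec n w =
    (if ascents n w = {} then \<Prod>i\<in>{1..n}. xv i ^ (n - i)
     else ddiff n (first_ascent n w) (schubert_rec n (w \<circ> stransp (first_ascent n w))))"
  by pat_completeness auto
termination
proof (relation "measure (\<lambda>(n, w). perm_weight n w)")
  fix n and w :: "nat \<Rightarrow> nat"
  assume "ascents n w \<noteq> {}"
  from first_ascent[OF this] have "perm_weight n (w \<circ> stransp (first_ascent n w)) < perm_weight n w"
    unfolding ascents_def by (intro perm_weight_stransp) blast+
  then show "((n, w \<circ> stransp (first_ascent n w)), n, w) \<in> measure (\<lambda>(n, w). perm_weight n w)"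
    by simp
qed (rule wf_measure)

declare schubert_rec.simps [simp del]

lemma schubert_rec_longest: "schubert_rec n (longest_perm n) = (\<Prod>i\<in>{1..n}. xv i ^ (n - i))"
  by (subst schubert_rec.simps) (use longest_perm_no_ascent in \<open>auto simp: ascents_def\<close>)

text \<open>The monomial is the single standard product of the e_p^(p) = x_1 ... x_p for p <
  n.\<close>

lemma staircase_xspan: "(\<Prod>i\<in>{1..n}. xv i ^ (n - i)) \<in> xspan n"
proof -
  have top: "celem (int p) p = (\<Prod>a\<in>{1..p}. xv a)" for p
    by (induction p) (auto simp: celem_0 celem_Suc C.E_large)
  have "(\<Prod>i\<in>{1..n}. xv i ^ (n - i)) = (\<Prod>p\<in>{1..n - 1}. celem (int p) p)"
  proof (induction n)
    case (Suc n)
    have "(\<Prod>i\<in>{1..Suc n}. xv i ^ (Suc n - i)) = (\<Prod>i\<in>{1..n}. xv i * xv i ^ (n - i))"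
      by (auto simp: Suc_diff_le intro!: prod.cong)
    also have "\<dots> = (\<Prod>p\<in>{1..Suc n - 1}. celem (int p) p)"
      unfolding prod.distrib Suc by (cases n) (simp_all add: top)
    finally show ?case .
  qed simp
  then have "(\<Prod>i\<in>{1..n}. xv i ^ (n - i)) = C.elem_prod n int"
    by (simp add: C.elem_prod_def)
  then show ?thesis
    using lift_rel_elem_prod[of n int] by (auto simp: xspan_def)
qed

text \<open>Independence of the chosen ascent, by induction on the weight. Membership in
  \<open>xspan n\<close> is carried along because the relations between divided differences are
  available there.\<close>

lemma schubert_rec_ascent:
  assumes "w permutes {1..n}"
  shows "schubert_rec n w \<in> xspan n \<and> (\<forall>j\<in>{1..n - 1}. w j < w (Suc j) \<longrightarrow>
    schubert_rec n w = ddiff n j (schubert_rec n (w \<circ> stransp j)))"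
  using assms
proof (induction "perm_weight n w" arbitrary: w rule: less_induct)
  case less
  let ?S = "schubert_rec n"
  have IH1: "?S (w \<circ> v) \<in> xspan n"
    if "perm_weight n (w \<circ> v) < perm_weight n w" "v permutes {1..n}" for v
    using less(1)[OF that(1)] permutes_compose[OF that(2) less(2)] by blast
  have IH2: "?S (w \<circ> v) = ddiff n j (?S (w \<circ> (v \<circ> stransp j)))"
    if "perm_weight n (w \<circ> v) < perm_weight n w" "v permutes {1..n}" "j \<in> {1..n - 1}"
      "w (v j) < w (v (Suc j))" for v j
    using less(1)[OF that(1)] permutes_compose[OF that(2) less(2)] that(3,4) by (simp add: comp_assoc)
  have lower: "perm_weight n (w \<circ> (v \<circ> stransp j)) < perm_weight n w \<and> (v \<circ> stransp j) permutes {1..n}"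
    if "perm_weight n (w \<circ> v) \<le> perm_weight n w" "v permutes {1..n}" "j \<in> {1..n - 1}" "w (v j) < w (v (Suc j))" for v j
    using perm_weight_stransp[of j n "w \<circ> v"] comp_stransp_permutes[of v n j] that by (simp add: comp_assoc)
  have diamond: "ddiff n k (?S (w \<circ> stransp k)) = ddiff n j (?S (w \<circ> stransp j))"
    if kj: "k \<in> {1..n - 1}" "j \<in> {1..n - 1}" "w k < w (Suc k)" "w j < w (Suc j)" "k < j" for k j
  proof -
    have k1: "perm_weight n (w \<circ> stransp k) < perm_weight n w" "stransp k permutes {1..n}"
      and j1: "perm_weight n (w \<circ> stransp j) < perm_weight n w" "stransp j permutes {1..n}"
      using kj by (blast intro: perm_weight_stransp stransp_permutes)+
    note k2 = lower[OF less_imp_le[OF k1(1)] k1(2) kj(2)]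
    note j2 = lower[OF less_imp_le[OF j1(1)] j1(2) kj(1)]
    show ?thesis
    proof (cases "j = Suc k")
      case False
      then have tr: "stransp k j = j" "stransp k (Suc j) = Suc j" "stransp j k = k" "stransp j (Suc k) = Suc k"
        using kj(5) by (auto simp: stransp_def transpose_def)
      \<comment> \<open>Distant ascents: both routes meet at w s_k s_j, and
        \<open>ddiff_commute\<close> applies.\<close>
      have comm: "stransp j \<circ> stransp k = stransp k \<circ> stransp j"
        using False kj(5) by (auto simp: stransp_def transpose_def fun_eq_iff)
      have *: "?S (w \<circ> (stransp k \<circ> stransp j)) \<in> xspan n"
        using k2 kj tr by (intro IH1) auto
      have "?S (w \<circ> stransp k) = ddiff n j (?S (w \<circ> (stransp k \<circ> stransp j)))"
        using IH2[OF k1 kj(2)] kj(4) by (simp only: tr)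
      moreover have "?S (w \<circ> stransp j) = ddiff n k (?S (w \<circ> (stransp k \<circ> stransp j)))"
        using IH2[OF j1 kj(1)] kj(3) by (simp only: tr comm)
      ultimately show ?thesis
        using ddiff_commute[OF * kj(1,2)] False kj(5) by simp
    next
      case True
      have tr: "stransp k k = j" "stransp k j = k" "stransp k (Suc j) = Suc j"
        "stransp j k = k" "stransp j j = Suc j" "stransp j (Suc j) = j"
        using True by (auto simp: stransp_def transpose_def)
      \<comment> \<open>The values at k, k + 1, k + 2 increase, so all swaps on the two routes of
        length three are at ascents; the routes meet at u, and \<open>ddiff_braid\<close>
        applies.\<close>
      have asc: "w k < w j" "w j < w (Suc j)" "w k < w (Suc j)"
        using kj True by auto
      have k2': "perm_weight n (w \<circ> (stransp k \<circ> stransp j)) < perm_weight n w" "(stransp k \<circ> stransp j) permutes {1..n}"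
        using k2 asc tr by auto
      have j2': "perm_weight n (w \<circ> (stransp j \<circ> stransp k)) < perm_weight n w" "(stransp j \<circ> stransp k) permutes {1..n}"
        using j2 asc tr True by auto
      have k3: "perm_weight n (w \<circ> (stransp k \<circ> stransp j \<circ> stransp k)) < perm_weight n w \<and>
          (stransp k \<circ> stransp j \<circ> stransp k) permutes {1..n}"
        using lower[OF less_imp_le[OF k2'(1)] k2'(2) kj(1)] asc tr True by simp
      define u where "u = stransp k \<circ> stransp j \<circ> stransp k"
      have u: "stransp j \<circ> stransp k \<circ> stransp j = u"
        unfolding u_def True by (auto simp: stransp_def transpose_def fun_eq_iff)
      have *: "?S (w \<circ> u) \<in> xspan n"
        using IH1 k3 unfolding u_def by blast
      have "?S (w \<circ> stransp k) = ddiff n j (ddiff n k (?S (w \<circ> u)))"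
        using IH2[OF k1 kj(2)] IH2[OF k2' kj(1)] asc by (simp add: tr u_def flip: True)
      moreover have "?S (w \<circ> stransp j) = ddiff n k (ddiff n j (?S (w \<circ> u)))"
        using IH2[OF j1 kj(1)] IH2[OF j2' kj(2)] asc by (simp add: tr u flip: True)
      ultimately show ?thesis
        using ddiff_braid[OF *] kj True by simp
    qed
  qed
  show ?case
  proof (cases "ascents n w = {}")
    case True
    then have "?S w = (\<Prod>i\<in>{1..n}. xv i ^ (n - i))"
      by (subst schubert_rec.simps) simp
    then show ?thesis
      using True staircase_xspan[of n] by (auto simp: ascents_def)
  next
    case False
    define k where "k = first_ascent n w"
    have k: "k \<in> {1..n - 1} \<and> w k < w (Suc k)"
      using first_ascent[OF False] by (simp add: k_def ascents_def)
    have S: "?S w = ddiff n k (?S (w \<circ> stransp k))"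
      by (subst schubert_rec.simps) (simp only: False if_False k_def)
    have "?S (w \<circ> stransp k) \<in> xspan n"
      using IH1[of "stransp k"] k perm_weight_stransp stransp_permutes by blast
    then have "?S w \<in> xspan n"
      using S k ddiff_xspan(1) by simp
    moreover have "?S w = ddiff n j (?S (w \<circ> stransp j))" if "j \<in> {1..n - 1}" "w j < w (Suc j)" for j
      using diamond[of k j] diamond[of j k] S k that by (cases k j rule: linorder_cases) auto
    ultimately show ?thesis by blast
  qed
qed

text \<open>Resolves the description. A descent of w at k is an ascent of w s_k, so
  \<open>schubert_rec_ascent\<close> gives the recursion; uniqueness is induction on the weight
  through \<open>exists_ascent\<close>.\<close>

lemma schubert_eq: "schubert n = (\<lambda>w. if w permutes {1..n} then schubert_rec n w else 0)"
  unfolding schubert_def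
proof (rule the_equality)
  let ?S = "\<lambda>w. if w permutes {1..n} then schubert_rec n w else 0"
  have "?S (w \<circ> stransp k) = ddiff n k (?S w)"
    if "w permutes {1..n}" "k \<in> {1..n - 1}" "w (k + 1) < w k" for w k
    using schubert_rec_ascent[OF comp_stransp_permutes[OF that(1,2)]] comp_stransp_permutes[OF that(1,2)] that
    by (auto simp: comp_stransp_twice stransp_apply)
  then show "?S (longest_perm n) = (\<Prod>i\<in>{1..n}. xv i ^ (n - i)) \<and>
     (\<forall>w k. w permutes {1..n} \<and> k \<in> {1..n - 1} \<and> w k > w (k + 1) \<longrightarrow>
        ?S (w \<circ> stransp k) = ddiff n k (?S w)) \<and>
     (\<forall>w. \<not> w permutes {1..n} \<longrightarrow> ?S w = 0)"
    by (simp add: longest_perm_permutes schubert_rec_longest del: One_nat_def)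
next
  let ?S = "\<lambda>w. if w permutes {1..n} then schubert_rec n w else 0"
  fix S assume S: "S (longest_perm n) = (\<Prod>i\<in>{1..n}. xv i ^ (n - i)) \<and>
     (\<forall>w k. w permutes {1..n} \<and> k \<in> {1..n - 1} \<and> w k > w (k + 1) \<longrightarrow>
        S (w \<circ> stransp k) = ddiff n k (S w)) \<and>
     (\<forall>w. \<not> w permutes {1..n} \<longrightarrow> S w = 0)"
  have "S w = schubert_rec n w" if "w permutes {1..n}" for w
    using that
  proof (induction "perm_weight n w" arbitrary: w rule: less_induct)
    case less
    show ?case
    proof (cases "w = longest_perm n")
      case True
      then show ?thesis using S by (simp add: schubert_rec_longest)
    next
      case False
      obtain k where k: "k \<in> {1..n - 1}" "w k < w (Suc k)"
        using exists_ascent[OF less(2) False] by blast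
      let ?v = "w \<circ> stransp k"
      have v: "?v permutes {1..n}" "?v (k + 1) < ?v k"
        using comp_stransp_permutes[OF less(2) k(1)] k by (auto simp: stransp_apply)
      then have "S (?v \<circ> stransp k) = ddiff n k (S ?v)"
        using S k(1) by blast
      also have "S ?v = schubert_rec n ?v"
        using less(1) perm_weight_stransp[OF k] v(1) by blast
      also have "ddiff n k (schubert_rec n ?v) = schubert_rec n w"
        using schubert_rec_ascent[OF less(2)] k by simp
      finally show ?thesis
        by (simp only: comp_stransp_twice)
    qed
  qed
  then show "S = ?S"
    using S by auto
qed

text \<open>Resolves \<open>schubert_coeff\<close>: an expansion exists because the polynomial lies
  in \<open>xspan n\<close>, and is unique by linear independence.\<close>

lemma schubert_lift:
  assumes "n \<ge> 1" "w permutes {1..n}"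
  shows "lift_by n (schubert_coeff n w) (schubert n w) (qschubert n w)"
proof -
  have "schubert n w \<in> xspan n"
    using assms schubert_rec_ascent by (simp add: schubert_eq)
  then obtain c where c: "schubert n w =
       (\<Sum>I\<in>elem_indices n. of_int (c I) * (\<Prod>p\<in>{1..n - 1}. elem_sym (I p) p))"
    by (auto simp: xspan_def lift_rel_def lift_by_def)
  define P where "P = (\<lambda>c. schubert n w =
       (\<Sum>I\<in>elem_indices n. of_int (c I) * (\<Prod>p\<in>{1..n - 1}. elem_sym (I p) p)) \<and>
     (\<forall>I. I \<notin> elem_indices n \<longrightarrow> c I = (0 :: int)))"
  let ?c = "\<lambda>I. if I \<in> elem_indices n then c I else 0"
  have "c' = ?c" if c': "P c'" for c'
  proof -
    have "c' I = c I" if "I \<in> elem_indices n" for I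
      by (rule elem_sym_prod_independent[OF assms(1) trans[OF sym[OF c'[unfolded P_def, THEN conjunct1]] c] that])
    then show ?thesis
      using c' by (auto simp: P_def)
  qed
  moreover have "P ?c"
    by (simp add: P_def c)
  ultimately have "P (THE c. P c)"
    by (metis theI)
  then have "P (schubert_coeff n w)"
    unfolding schubert_coeff_def P_def .
  then show ?thesis
    by (simp add: P_def lift_by_def qschubert_def)
qed

text \<open>The classical polynomial of w s_k has two quantizations: its own, and the G' from
  \<open>ddiff_lift_by\<close>. They agree by \<open>lift_rel_unique\<close>.\<close>

lemma ddiff_qschubert_descent:
  assumes "n \<ge> 2" "w permutes {1..n}" "k \<in> {1..n - 1}" "w (Suc k) < w k"
  shows "ddiff n k (qschubert n w) = qschubert n (w \<circ> stransp k) + eta_qschubert n k w"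
    and "(xv k - xv (Suc k)) * ddiff n k (qschubert n w) = qschubert n w - sact n k (qschubert n w)"
proof -
  have n: "n \<ge> 1" using assms by simp
  have v: "(w \<circ> stransp k) permutes {1..n}"
    by (rule comp_stransp_permutes[OF assms(2,3)])
  have "schubert_rec n (w \<circ> stransp k) = ddiff n k (schubert_rec n w)"
    using schubert_rec_ascent[OF v] assms by (auto simp: comp_stransp_twice stransp_apply)
  then have S: "schubert n (w \<circ> stransp k) = ddiff n k (schubert n w)"
    using assms v by (simp add: schubert_eq)
  obtain G' where G': "lift_rel n (ddiff n k (schubert n w)) G'"
    "ddiff n k (qschubert n w) = G' + eta_qschubert n k w"
    "(xv k - xv (Suc k)) * ddiff n k (qschubert n w) = qschubert n w - sact n k (qschubert n w)"
    by (rule ddiff_lift_by[OF assms(3) schubert_lift[OF n assms(2)], folded eta_qschubert_def]) (rule that)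
  have "lift_rel n (ddiff n k (schubert n w)) (qschubert n (w \<circ> stransp k))"
    using schubert_lift[OF n v] unfolding S lift_rel_def by blast
  from lift_rel_unique[OF n this G'(1)]
  show "ddiff n k (qschubert n w) = qschubert n (w \<circ> stransp k) + eta_qschubert n k w"
    using G'(2) by simp
  show "(xv k - xv (Suc k)) * ddiff n k (qschubert n w) = qschubert n w - sact n k (qschubert n w)"
    by (rule G'(3))
qed

text \<open>Here \<open>\<SS>\<^sub>w\<^sup>q = \<partial>\<^sub>k \<SS>\<^sub>v\<^sup>q - \<eta>\<^sub>k \<SS>\<^sub>v\<^sup>q\<close> for \<open>v = w s\<^sub>k\<close>, and both terms are \<open>s\<^sub>k\<close>-invariant.\<close>

lemma ddiff_qschubert_ascent:
  assumes "n \<ge> 2" "w permutes {1..n}" "k \<in> {1..n - 1}" "w k < w (Suc k)"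
  shows "ddiff n k (qschubert n w) = 0"
proof -
  define v where "v = w \<circ> stransp k"
  define D where "D = ddiff n k (qschubert n v)"
  have v: "v permutes {1..n}" "v (Suc k) < v k" "v \<circ> stransp k = w"
    using comp_stransp_permutes[OF assms(2,3)] assms(4) by (simp_all add: v_def comp_stransp_twice stransp_apply)
  note D = ddiff_qschubert_descent[OF assms(1) v(1) assms(3) v(2), folded D_def, unfolded v(3)]
  have w_eq: "qschubert n w = D - eta_qschubert n k v"
    using D(1) by simp
  have inv: "sact n k (sact n k (qschubert n v)) = qschubert n v"
    unfolding qschubert_def qelem_prod_eq C.s_sum[of n] sact_mult C.s_of_int[of n] Q.s_s_elem_prod[OF assms(3)] ..
  \<comment> \<open>s_k negates both x_k - x_(k+1) and its product with D, since that product is a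
    polynomial minus its image under s_k; hence s_k fixes D.\<close>
  have "(xv k - xv (Suc k)) * sact n k D = - sact n k ((xv k - xv (Suc k)) * D)"
    by (simp add: sact_mult sact_diff sact_xv stransp_def algebra_simps)
  also have "\<dots> = (xv k - xv (Suc k)) * D"
    unfolding D(2) sact_diff inv by simp
  finally have "(xv k - xv (Suc k)) * sact n k D = (xv k - xv (Suc k)) * D" .
  then have "sact n k D = D"
    by (simp add: xv_eq_iff)
  moreover have "sact n k (eta_qschubert n k v) = eta_qschubert n k v"
    unfolding eta_qschubert_def C.s_sum[of n] sact_mult C.s_of_int[of n] sact_eta_elem[OF assms(3)] ..
  ultimately have "sact n k (qschubert n w) = qschubert n w"
    by (simp add: w_eq sact_diff)
  then show ?thesis
    by (intro ddiffI) (simp_all add: ringR_0)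
qed

theorem theorem1p4:
  fixes n k :: nat and w :: "nat \<Rightarrow> nat"
  assumes "n \<ge> 2" and "w permutes {1..n}" and "k \<in> {1..n - 1}"
  shows "(w k > w (k + 1) \<longrightarrow>
            ddiff n k (qschubert n w) = qschubert n (w \<circ> stransp k) + eta_qschubert n k w) \<and>
         (w k < w (k + 1) \<longrightarrow> ddiff n k (qschubert n w) = 0)"
  using ddiff_qschubert_descent(1)[OF assms] ddiff_qschubert_ascent[OF assms] by simp

end
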